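(* Let $C>0$ and let $a_1,a_2,a_3$ be three real constants, not all of them equal to each other. On the product of the seven dimensional quaternionic Heisenberg group ($\cong\mathbb R^7$ with coordinates $x_1,\dots,x_7$) with the interval of the real line $\{u\in\mathbb R: u+a_1>0,\ u+a_2>0,\ u+a_3>0\}$, the metric $$\begin{aligned} g=\;&C\,\big((u+a_1)(u+a_2)(u+a_3)\big)^{1/9}(dx_1^2+dx_2^2+dx_3^2+dx_4^2)\\ &+\frac6C\left(\frac{(u+a_2)^8(u+a_3)^8}{(u+a_1)^{10}}\right)^{1/9}(dx_5+2x_1dx_2+2x_3dx_4)^2\\ &+\frac6C\left(\frac{(u+a_3)^8(u+a_1)^8}{(u+a_2)^{10}}\right)^{1/9}(dx_6+2x_1dx_3+2x_4dx_2)^2\\ &+\frac6C\left(\frac{(u+a_1)^8(u+a_2)^8}{(u+a_3)^{10}}\right)^{1/9}(dx_7+2x_1dx_4+2x_2dx_3)^2\\ &+\left(\frac C6\right)^3\frac{du^2}{\big((u+a_1)(u+a_2)(u+a_3)\big)^{2/3}} \end{aligned}$$ supports an almost quaternion hermitian structure which has closed fundamental $4$-form, but is not quaternionic Kähler.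
   Context: An almost quaternion hermitian structure on an $8$-manifold is a Riemannian metric $g$ together with a rank-three bundle of endomorphisms locally generated by almost complex structures $J_1,J_2,J_3$ satisfying $J_1J_2=-J_2J_1=J_3$ and $g(J_s\cdot,J_s\cdot)=g(\cdot,\cdot)$. With the local 2-forms $F_s(\cdot,\cdot)=g(J_s\cdot,\cdot)$, the fundamental $4$-form is $\Phi=F_1\wedge F_1+F_2\wedge F_2+F_3\wedge F_3$ (globally defined). The structure is quaternionic Kähler if the holonomy of the Levi-Civita connection is contained in $Sp(2)Sp(1)$ (with respect to this structure), equivalently if $\Phi$ is parallel with respect to the Levi-Civita connection. The seven dimensional quaternionic Heisenberg group is the simply connected Lie group with left-invariant forms $e^a=dx_a$ ($1\le a\le4$) and $\eta_1=dx_5+2x_1dx_2+2x_3dx_4$, $\eta_2=dx_6+2x_1dx_3+2x_4dx_2$, $\eta_3=dx_7+2x_1dx_4+2x_2dx_3$, satisfying $de^a=0$, $d\eta_1=2(e^{12}+e^{34})$, $d\eta_2=2(e^{13}+e^{42})$, $d\eta_3=2(e^{14}+e^{23})$. *)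

theory Defs
  imports "HOL-Analysis.Analysis"
begin

text \<open>
  The manifolds here are open subsets \<open>M\<close> of a Euclidean space \<open>'a\<close>, and every tangent space is
  identified with \<open>'a\<close>. A covariant tensor field is a function of the base point followed by its
  vector arguments, and an endomorphism field has type \<open>'a \<Rightarrow> 'a \<Rightarrow> 'a\<close>. Values at
  base points outside \<open>M\<close> are irrelevant.
\<close>

definition dir_deriv :: "('a::euclidean_space \<Rightarrow> 'b::real_normed_vector) \<Rightarrow> 'a \<Rightarrow> 'a \<Rightarrow> 'b" where
  "dir_deriv f p v = frechet_derivative f (at p) v"

text \<open>Continuous differentiability of order \<open>k\<close>; only meaningful for open \<open>S\<close>.\<close>

primrec C_on :: "nat \<Rightarrow> 'a::euclidean_space set \<Rightarrow> ('a \<Rightarrow> 'b::real_normed_vector) \<Rightarrow> bool" where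
  "C_on 0 S f \<longleftrightarrow> continuous_on S f"
| "C_on (Suc k) S f \<longleftrightarrow>
     (\<forall>p\<in>S. f differentiable (at p)) \<and> (\<forall>v. C_on k S (\<lambda>p. dir_deriv f p v))"

definition smooth_on :: "'a::euclidean_space set \<Rightarrow> ('a \<Rightarrow> 'b::real_normed_vector) \<Rightarrow> bool" where
  "smooth_on S f \<longleftrightarrow> (\<forall>k. C_on k S f)"

definition riemannian_metric_on ::
  "'a::euclidean_space set \<Rightarrow> ('a \<Rightarrow> 'a \<Rightarrow> 'a \<Rightarrow> real) \<Rightarrow> bool" where
  "riemannian_metric_on M g \<longleftrightarrow>
     (\<forall>v w. smooth_on M (\<lambda>p. g p v w)) \<and>
     (\<forall>p\<in>M. bilinear (g p) \<and> (\<forall>v w. g p v w = g p w v) \<and> (\<forall>v. v \<noteq> 0 \<longrightarrow> g p v v > 0))"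


subsection \<open>Almost quaternion hermitian structures\<close>

text \<open>The pointwise algebraic conditions on \<open>J\<^sub>1, J\<^sub>2, J\<^sub>3\<close> with respect to an inner product \<open>h\<close>.\<close>

definition quaternionic_triple ::
  "('a::euclidean_space \<Rightarrow> 'a \<Rightarrow> real) \<Rightarrow> ('a \<Rightarrow> 'a) \<Rightarrow> ('a \<Rightarrow> 'a) \<Rightarrow> ('a \<Rightarrow> 'a) \<Rightarrow> bool" where
  "quaternionic_triple h J1 J2 J3 \<longleftrightarrow>
     (\<forall>J\<in>{J1, J2, J3}. linear J \<and> (\<forall>v. J (J v) = - v) \<and> (\<forall>v w. h (J v) (J w) = h v w)) \<and>
     (\<forall>v. J1 (J2 v) = J3 v \<and> J2 (J1 v) = - J3 v)"

text \<open>The real span of three endomorphisms; the function type is not a \<open>real_vector\<close> instance,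
  so \<open>span\<close> is not available. For a quaternionic triple the span has dimension three.\<close>

definition endo_span :: "('a::real_vector \<Rightarrow> 'a) \<Rightarrow> ('a \<Rightarrow> 'a) \<Rightarrow> ('a \<Rightarrow> 'a) \<Rightarrow> ('a \<Rightarrow> 'a) set" where
  "endo_span J1 J2 J3 = {(\<lambda>v. a *\<^sub>R J1 v + b *\<^sub>R J2 v + c *\<^sub>R J3 v) | a b c. True}"

text \<open>\<open>Q\<close> assigns to each point the fibre of the bundle of endomorphisms.\<close>

definition almost_quaternion_hermitian ::
  "'a::euclidean_space set \<Rightarrow> ('a \<Rightarrow> 'a \<Rightarrow> 'a \<Rightarrow> real) \<Rightarrow> ('a \<Rightarrow> ('a \<Rightarrow> 'a) set) \<Rightarrow> bool" where
  "almost_quaternion_hermitian M g Q \<longleftrightarrow>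
     riemannian_metric_on M g \<and>
     (\<forall>p\<in>M. \<exists>U J1 J2 J3. open U \<and> p \<in> U \<and> U \<subseteq> M \<and>
        (\<forall>J\<in>{J1, J2, J3}. \<forall>v. smooth_on U (\<lambda>q. J q v)) \<and>
        (\<forall>q\<in>U. quaternionic_triple (g q) (J1 q) (J2 q) (J3 q) \<and>
                Q q = endo_span (J1 q) (J2 q) (J3 q)))"


subsection \<open>The fundamental 4-form\<close>

text \<open>Wedge product of two 2-forms at a point: the sum over (2,2)-shuffles.\<close>

definition wedge22 :: "('a \<Rightarrow> 'a \<Rightarrow> real) \<Rightarrow> ('a \<Rightarrow> 'a \<Rightarrow> real) \<Rightarrow> 'a \<Rightarrow> 'a \<Rightarrow> 'a \<Rightarrow> 'a \<Rightarrow> real" where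
  "wedge22 \<alpha> \<beta> X Y Z W =
     \<alpha> X Y * \<beta> Z W - \<alpha> X Z * \<beta> Y W + \<alpha> X W * \<beta> Y Z
     + \<alpha> Y Z * \<beta> X W - \<alpha> Y W * \<beta> X Z + \<alpha> Z W * \<beta> X Y"

definition two_form :: "('a \<Rightarrow> 'a \<Rightarrow> real) \<Rightarrow> ('a \<Rightarrow> 'a) \<Rightarrow> 'a \<Rightarrow> 'a \<Rightarrow> real" where
  "two_form h J X Y = h (J X) Y"

text \<open>The value at \<open>p\<close> does not depend on the quaternionic triple generating \<open>Q p\<close> (two such triples
  differ by a rotation), so the definite description is proper.\<close>

definition fundamental_form ::
  "('a::euclidean_space \<Rightarrow> 'a \<Rightarrow> 'a \<Rightarrow> real) \<Rightarrow> ('a \<Rightarrow> ('a \<Rightarrow> 'a) set) \<Rightarrow>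
   'a \<Rightarrow> 'a \<Rightarrow> 'a \<Rightarrow> 'a \<Rightarrow> 'a \<Rightarrow> real" where
  "fundamental_form g Q p = (THE \<phi>. \<exists>J1 J2 J3.
     quaternionic_triple (g p) J1 J2 J3 \<and> Q p = endo_span J1 J2 J3 \<and>
     \<phi> = (\<lambda>X Y Z W. \<Sum>J\<leftarrow>[J1, J2, J3].
            wedge22 (two_form (g p) J) (two_form (g p) J) X Y Z W))"

text \<open>Exterior derivative of a 4-form, by the invariant formula on constant vector fields (whose Lie
  brackets vanish).\<close>

definition ext_deriv4 ::
  "('a::euclidean_space \<Rightarrow> 'a \<Rightarrow> 'a \<Rightarrow> 'a \<Rightarrow> 'a \<Rightarrow> real) \<Rightarrow>
   'a \<Rightarrow> 'a \<Rightarrow> 'a \<Rightarrow> 'a \<Rightarrow> 'a \<Rightarrow> 'a \<Rightarrow> real" where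
  "ext_deriv4 \<omega> p V X Y Z W =
     dir_deriv (\<lambda>q. \<omega> q X Y Z W) p V - dir_deriv (\<lambda>q. \<omega> q V Y Z W) p X
     + dir_deriv (\<lambda>q. \<omega> q V X Z W) p Y - dir_deriv (\<lambda>q. \<omega> q V X Y W) p Z
     + dir_deriv (\<lambda>q. \<omega> q V X Y Z) p W"

definition closed_form4_on ::
  "'a::euclidean_space set \<Rightarrow> ('a \<Rightarrow> 'a \<Rightarrow> 'a \<Rightarrow> 'a \<Rightarrow> 'a \<Rightarrow> real) \<Rightarrow> bool" where
  "closed_form4_on M \<omega> \<longleftrightarrow> (\<forall>p\<in>M. \<forall>V X Y Z W. ext_deriv4 \<omega> p V X Y Z W = 0)"


subsection \<open>Levi-Civita connection and quaternionic Kaehler structures\<close>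

text \<open>\<open>levi_civita g p X Y\<close> is the covariant derivative at \<open>p\<close> of the constant vector field \<open>Y\<close> in
  direction \<open>X\<close> (the Christoffel symbols). The conditions say that the connection is torsion-free
  and metric.\<close>

definition levi_civita ::
  "('a::euclidean_space \<Rightarrow> 'a \<Rightarrow> 'a \<Rightarrow> real) \<Rightarrow> 'a \<Rightarrow> 'a \<Rightarrow> 'a \<Rightarrow> 'a" where
  "levi_civita g p = (THE \<Gamma>. bilinear \<Gamma> \<and> (\<forall>X Y. \<Gamma> X Y = \<Gamma> Y X) \<and>
     (\<forall>X Y Z. dir_deriv (\<lambda>q. g q Y Z) p X = g p (\<Gamma> X Y) Z + g p Y (\<Gamma> X Z)))"

definition cov_deriv4 ::
  "('a::euclidean_space \<Rightarrow> 'a \<Rightarrow> 'a \<Rightarrow> real) \<Rightarrow> ('a \<Rightarrow> 'a \<Rightarrow> 'a \<Rightarrow> 'a \<Rightarrow> 'a \<Rightarrow> real) \<Rightarrow>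
   'a \<Rightarrow> 'a \<Rightarrow> 'a \<Rightarrow> 'a \<Rightarrow> 'a \<Rightarrow> 'a \<Rightarrow> real" where
  "cov_deriv4 g \<omega> p V X Y Z W = dir_deriv (\<lambda>q. \<omega> q X Y Z W) p V
     - \<omega> p (levi_civita g p V X) Y Z W - \<omega> p X (levi_civita g p V Y) Z W
     - \<omega> p X Y (levi_civita g p V Z) W - \<omega> p X Y Z (levi_civita g p V W)"

definition parallel_form4_on ::
  "'a::euclidean_space set \<Rightarrow> ('a \<Rightarrow> 'a \<Rightarrow> 'a \<Rightarrow> real) \<Rightarrow>
   ('a \<Rightarrow> 'a \<Rightarrow> 'a \<Rightarrow> 'a \<Rightarrow> 'a \<Rightarrow> real) \<Rightarrow> bool" where
  "parallel_form4_on M g \<omega> \<longleftrightarrow> (\<forall>p\<in>M. \<forall>V X Y Z W. cov_deriv4 g \<omega> p V X Y Z W = 0)"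

text \<open>Holonomy contained in \<open>Sp(2)Sp(1)\<close> with respect to the given structure (and not just to
  some structure) means that the fundamental 4-form is parallel.\<close>

definition quaternionic_kaehler ::
  "'a::euclidean_space set \<Rightarrow> ('a \<Rightarrow> 'a \<Rightarrow> 'a \<Rightarrow> real) \<Rightarrow> ('a \<Rightarrow> ('a \<Rightarrow> 'a) set) \<Rightarrow> bool" where
  "quaternionic_kaehler M g Q \<longleftrightarrow>
     almost_quaternion_hermitian M g Q \<and> parallel_form4_on M g (fundamental_form g Q)"


subsection \<open>The metric\<close>

text \<open>A point is \<open>(x, u)\<close> with \<open>x\<close> in the quaternionic Heisenberg group. The left-invariant forms
  \<open>\<eta>\<^sub>s\<close> are evaluated at \<open>x\<close> on a tangent vector \<open>\<xi>\<close>, whose components are \<open>dx\<^sub>i(\<xi>)\<close>.\<close>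

definition eta1 :: "real^7 \<Rightarrow> real^7 \<Rightarrow> real" where
  "eta1 x \<xi> = \<xi>$5 + 2 * x$1 * \<xi>$2 + 2 * x$3 * \<xi>$4"

definition eta2 :: "real^7 \<Rightarrow> real^7 \<Rightarrow> real" where
  "eta2 x \<xi> = \<xi>$6 + 2 * x$1 * \<xi>$3 + 2 * x$4 * \<xi>$2"

definition eta3 :: "real^7 \<Rightarrow> real^7 \<Rightarrow> real" where
  "eta3 x \<xi> = \<xi>$7 + 2 * x$1 * \<xi>$4 + 2 * x$2 * \<xi>$3"

definition heis_domain :: "real \<Rightarrow> real \<Rightarrow> real \<Rightarrow> ((real^7) \<times> real) set" where
  "heis_domain a1 a2 a3 = UNIV \<times> {u. u + a1 > 0 \<and> u + a2 > 0 \<and> u + a3 > 0}"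

definition heis_metric ::
  "real \<Rightarrow> real \<Rightarrow> real \<Rightarrow> real \<Rightarrow> (real^7) \<times> real \<Rightarrow> (real^7) \<times> real \<Rightarrow> (real^7) \<times> real \<Rightarrow> real" where
  "heis_metric C a1 a2 a3 = (\<lambda>(x, u) (\<xi>, s) (\<zeta>, t).
     C * ((u + a1) * (u + a2) * (u + a3)) powr (1/9) *
       (\<xi>$1 * \<zeta>$1 + \<xi>$2 * \<zeta>$2 + \<xi>$3 * \<zeta>$3 + \<xi>$4 * \<zeta>$4)
     + 6 / C * ((u + a2)^8 * (u + a3)^8 / (u + a1)^10) powr (1/9) * (eta1 x \<xi> * eta1 x \<zeta>)
     + 6 / C * ((u + a3)^8 * (u + a1)^8 / (u + a2)^10) powr (1/9) * (eta2 x \<xi> * eta2 x \<zeta>)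
     + 6 / C * ((u + a1)^8 * (u + a2)^8 / (u + a3)^10) powr (1/9) * (eta3 x \<xi> * eta3 x \<zeta>)
     + (C / 6)^3 * (s * t) / ((u + a1) * (u + a2) * (u + a3)) powr (2/3))"

end

theory Submission
  imports Defs
begin

text \<open>
  Put \<open>u\<^sub>s = u + a\<^sub>s\<close> and \<open>r = (u\<^sub>1 u\<^sub>2 u\<^sub>3)\<^sup>1\<^sup>/\<^sup>9\<close>. In the coframe \<open>e\<^sub>i, \<eta>\<^sub>s, du\<close> the metric is
  diagonal with coefficients rational in \<open>r\<close> and the \<open>u\<^sub>s\<close>. With \<open>\<sigma>\<^sub>s = d\<eta>\<^sub>s / 2\<close> the structure
  is given by the 2-forms
  \<open>F\<^sub>s = C r \<sigma>\<^sub>s + (6 u\<^sub>s / (C r)) \<eta>\<^sub>j \<and> \<eta>\<^sub>k - (C r / (6 u\<^sub>s)) \<eta>\<^sub>s \<and> du\<close>, \<open>(s, j, k)\<close> cyclic.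
  In \<open>d\<Phi> = 2 (dF\<^sub>1 \<and> F\<^sub>1 + dF\<^sub>2 \<and> F\<^sub>2 + dF\<^sub>3 \<and> F\<^sub>3)\<close> only the components \<open>du \<and> \<sigma>\<^sub>1 \<and> \<sigma>\<^sub>1\<close> and
  \<open>du \<and> \<sigma>\<^sub>s \<and> \<eta>\<^sub>j \<and> \<eta>\<^sub>k\<close> survive, and their coefficients cancel because
  \<open>9 r' / r = 1 / u\<^sub>1 + 1 / u\<^sub>2 + 1 / u\<^sub>3\<close>.
  If \<open>\<Phi>\<close> were parallel, its covariant derivative along the vector dual to \<open>\<eta>\<^sub>s\<close> would vanish. That
  vector rotates the horizontal space and the plane spanned by itself and the \<open>u\<close>-direction, and the two
  rates match only if \<open>1 / u\<^sub>1 + 1 / u\<^sub>2 + 1 / u\<^sub>3 = 3 / u\<^sub>s\<close>. For \<open>s = 1, 2\<close> this forces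
  \<open>a\<^sub>1 = a\<^sub>2 = a\<^sub>3\<close>.
\<close>


subsection \<open>Smooth functions\<close>

lemma dir_deriv_eq:
  assumes "(f has_derivative f') (at p)"
  shows "dir_deriv f p v = f' v"
  unfolding dir_deriv_def using frechet_derivative_at[OF assms] by metis

text \<open>\<open>frechet_derivative\<close> is a choice from the has-derivative predicate, so
  functions agreeing near p get the same choice, differentiable or not. This allows closed formulas
  valid only on the open domain to be substituted under a derivative.\<close>

lemma dir_deriv_cong:
  assumes "open S" "p \<in> S" "\<And>q. q \<in> S \<Longrightarrow> f q = g q"
  shows "dir_deriv f p v = dir_deriv g p v"
proof -
  have "(f has_derivative D) (at p) = (g has_derivative D) (at p)" for D
    using has_derivative_transform_within_open[OF _ assms(1,2)] assms(3) by metis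
  then show ?thesis
    unfolding dir_deriv_def frechet_derivative_def by simp
qed

lemma has_derivative_dir_deriv:
  assumes "f differentiable (at p)"
  shows "(f has_derivative dir_deriv f p) (at p)"
  using assms unfolding dir_deriv_def frechet_derivative_works by (simp add: eta_contract_eq)

lemma C_on_cong:
  assumes "open S" "\<And>q. q \<in> S \<Longrightarrow> f q = g q"
  shows "C_on k S f = C_on k S g"
  using assms(2)
proof (induction k arbitrary: f g)
  case 0
  then show ?case by (simp cong: continuous_on_cong)
next
  case (Suc k)
  have "f differentiable (at p) \<longleftrightarrow> g differentiable (at p)" if "p \<in> S" for p
    using has_derivative_transform_within_open[OF _ assms(1) that] Suc.prems
    unfolding differentiable_def by metis
  moreover have "C_on k S (\<lambda>p. dir_deriv f p v) = C_on k S (\<lambda>p. dir_deriv g p v)" for v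
    by (intro Suc.IH dir_deriv_cong[OF assms(1)] Suc.prems)
  ultimately show ?case by simp
qed

text \<open>Product and power rules leave undifferentiated factors beside derivatives; lowering the
  order lets the induction hypothesis treat both.\<close>

lemma C_on_Suc_imp: "C_on (Suc k) S f \<Longrightarrow> C_on k S f"
proof (induction k arbitrary: f)
  case 0
  then show ?case
    by (auto intro!: continuous_at_imp_continuous_on differentiable_imp_continuous_within)
next
  case (Suc k)
  show ?case
    unfolding C_on.simps(2)[of k]
  proof (intro conjI allI)
    show "\<forall>p\<in>S. f differentiable at p"
      using Suc.prems by simp
    show "C_on k S (\<lambda>p. dir_deriv f p v)" for v
      using Suc.IH Suc.prems by simp
  qed
qed

text \<open>Replaces the chosen derivative by an explicit formula, the form in which every closure
  property below is proved.\<close>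

lemma C_on_SucI:
  assumes "open S"
    and "\<And>p. p \<in> S \<Longrightarrow> (f has_derivative (\<lambda>v. f' v p)) (at p)"
    and "\<And>v. C_on k S (f' v)"
  shows "C_on (Suc k) S f"
proof -
  have "C_on k S (\<lambda>p. dir_deriv f p v)" for v
    using assms(3)[of v] C_on_cong[OF assms(1), of "\<lambda>p. dir_deriv f p v" "f' v" k]
      dir_deriv_eq[OF assms(2)] by simp
  then show ?thesis
    using assms(2) by (auto simp: differentiable_def)
qed

lemma C_on_const: "open S \<Longrightarrow> C_on k S (\<lambda>_. c)"
  by (induction k arbitrary: c)
    (auto intro!: C_on_SucI[where f' = "\<lambda>_ _. 0"] derivative_eq_intros simp del: C_on.simps(2))

lemma C_on_bounded_linear: "open S \<Longrightarrow> bounded_linear f \<Longrightarrow> C_on k S f"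
  by (cases k) (auto intro!: C_on_SucI[where f' = "\<lambda>v _. f v"] C_on_const
      bounded_linear_imp_has_derivative linear_continuous_on simp del: C_on.simps(2))

lemma C_on_add:
  assumes "open S"
  shows "C_on k S f \<Longrightarrow> C_on k S g \<Longrightarrow> C_on k S (\<lambda>p. f p + g p)"
proof (induction k arbitrary: f g)
  case 0
  then show ?case by (auto intro: continuous_intros)
next
  case (Suc k)
  show ?case
  proof (rule C_on_SucI[OF assms, where f' = "\<lambda>v p. dir_deriv f p v + dir_deriv g p v"])
    show "((\<lambda>p. f p + g p) has_derivative (\<lambda>v. dir_deriv f p v + dir_deriv g p v)) (at p)"
      if "p \<in> S" for p
      using Suc.prems that by (auto intro!: has_derivative_add has_derivative_dir_deriv)
    show "C_on k S (\<lambda>p. dir_deriv f p v + dir_deriv g p v)" for v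
      using Suc by simp
  qed
qed

lemma C_on_scaleR:
  fixes f :: "_ \<Rightarrow> real"
  assumes "open S"
  shows "C_on k S f \<Longrightarrow> C_on k S g \<Longrightarrow> C_on k S (\<lambda>p. f p *\<^sub>R g p)"
proof (induction k arbitrary: f g)
  case 0
  then show ?case by (auto intro: continuous_intros)
next
  case (Suc k)
  show ?case
  proof (rule C_on_SucI[OF assms,
        where f' = "\<lambda>v p. f p *\<^sub>R dir_deriv g p v + dir_deriv f p v *\<^sub>R g p"])
    show "((\<lambda>p. f p *\<^sub>R g p) has_derivative
        (\<lambda>v. f p *\<^sub>R dir_deriv g p v + dir_deriv f p v *\<^sub>R g p)) (at p)"
      if "p \<in> S" for p
      using Suc.prems that by (auto intro!: has_derivative_scaleR has_derivative_dir_deriv)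
    show "C_on k S (\<lambda>p. f p *\<^sub>R dir_deriv g p v + dir_deriv f p v *\<^sub>R g p)" for v
      using Suc.prems C_on_Suc_imp[OF Suc.prems(1)] C_on_Suc_imp[OF Suc.prems(2)]
      by (intro C_on_add assms Suc.IH) simp_all
  qed
qed

lemma C_on_mult:
  fixes f g :: "_ \<Rightarrow> real"
  shows "open S \<Longrightarrow> C_on k S f \<Longrightarrow> C_on k S g \<Longrightarrow> C_on k S (\<lambda>p. f p * g p)"
  using C_on_scaleR[of S k f g] by simp

text \<open>The induction keeps the exponent arbitrary, because differentiating lowers it by one.
  Positivity keeps the base away from the singularity at 0.\<close>

lemma C_on_powr:
  fixes f :: "_ \<Rightarrow> real"
  assumes "open S" and pos: "\<And>p. p \<in> S \<Longrightarrow> f p > 0"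
  shows "C_on k S f \<Longrightarrow> C_on k S (\<lambda>p. f p powr r)"
proof (induction k arbitrary: r)
  case 0
  then show ?case using pos by (force intro!: continuous_intros)
next
  case (Suc k)
  show ?case
  proof (rule C_on_SucI[OF assms(1),
        where f' = "\<lambda>v p. (r * f p powr (r - 1)) *\<^sub>R dir_deriv f p v"])
    show "((\<lambda>p. f p powr r) has_derivative
        (\<lambda>v. (r * f p powr (r - 1)) *\<^sub>R dir_deriv f p v)) (at p)"
      if "p \<in> S" for p
    proof -
      have "(f has_derivative dir_deriv f p) (at p)"
        using Suc.prems that by (simp add: has_derivative_dir_deriv)
      then have "((\<lambda>p. f p powr r) has_derivative
        (\<lambda>v. f p powr r * (0 * ln (f p) + dir_deriv f p v * r / f p))) (at p)"
        by (rule has_derivative_powr) (use pos[OF that] in \<open>auto intro: derivative_intros\<close>)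
      moreover have "f p powr r * (0 * ln (f p) + d * r / f p) = (r * f p powr (r - 1)) *\<^sub>R d" for d
        using pos[OF that] by (simp add: powr_diff)
      ultimately show ?thesis
        by simp
    qed
    show "C_on k S (\<lambda>p. (r * f p powr (r - 1)) *\<^sub>R dir_deriv f p v)" for v
      using Suc.prems C_on_Suc_imp[OF Suc.prems]
      by (intro C_on_scaleR[OF assms(1)] C_on_mult[OF assms(1)] Suc.IH C_on_const[OF assms(1)]) simp_all
  qed
qed

lemma smooth_on_const: "open S \<Longrightarrow> smooth_on S (\<lambda>_. c)"
  and smooth_on_bounded_linear: "open S \<Longrightarrow> bounded_linear l \<Longrightarrow> smooth_on S l"
  and smooth_on_add: "open S \<Longrightarrow> smooth_on S f \<Longrightarrow> smooth_on S g \<Longrightarrow> smooth_on S (\<lambda>p. f p + g p)"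
  and smooth_on_scaleR: "open S \<Longrightarrow> smooth_on S a \<Longrightarrow> smooth_on S f \<Longrightarrow> smooth_on S (\<lambda>p. a p *\<^sub>R f p)"
  and smooth_on_powr: "open S \<Longrightarrow> smooth_on S a \<Longrightarrow> (\<And>p. p \<in> S \<Longrightarrow> a p > 0) \<Longrightarrow> smooth_on S (\<lambda>p. a p powr r)"
  unfolding smooth_on_def
  by (blast intro: C_on_const C_on_bounded_linear C_on_add C_on_scaleR C_on_powr)+

lemma smooth_on_cong:
  "open S \<Longrightarrow> (\<And>q. q \<in> S \<Longrightarrow> f q = g q) \<Longrightarrow> smooth_on S f = smooth_on S g"
  unfolding smooth_on_def using C_on_cong by metis

lemma smooth_on_mult:
  fixes f g :: "_ \<Rightarrow> real"
  shows "open S \<Longrightarrow> smooth_on S f \<Longrightarrow> smooth_on S g \<Longrightarrow> smooth_on S (\<lambda>p. f p * g p)"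
  using smooth_on_scaleR[of S f g] by simp

lemma smooth_on_imp_differentiable: "smooth_on S f \<Longrightarrow> p \<in> S \<Longrightarrow> f differentiable (at p)"
  unfolding smooth_on_def by (metis C_on.simps(2))

lemma smooth_on_minus: "open S \<Longrightarrow> smooth_on S f \<Longrightarrow> smooth_on S (\<lambda>p. - f p)"
  using smooth_on_scaleR[OF _ smooth_on_const, of S f "-1"] by simp

lemma smooth_on_power:
  fixes f :: "_ \<Rightarrow> real"
  shows "open S \<Longrightarrow> smooth_on S f \<Longrightarrow> smooth_on S (\<lambda>p. f p ^ n)"
  by (induction n) (auto intro: smooth_on_const smooth_on_mult)

lemma smooth_on_divide:
  fixes f h :: "_ \<Rightarrow> real"
  assumes "open S" "smooth_on S f" "smooth_on S h" "\<And>p. p \<in> S \<Longrightarrow> h p > 0"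
  shows "smooth_on S (\<lambda>p. f p / h p)"
proof -
  have "smooth_on S (\<lambda>p. f p * h p powr (- 1))"
    by (intro smooth_on_mult smooth_on_powr assms)
  moreover have "f p * h p powr (- 1) = f p / h p" if "p \<in> S" for p
    using assms(4)[OF that] by (simp add: powr_minus divide_inverse)
  ultimately show ?thesis
    using smooth_on_cong[OF assms(1), of "\<lambda>p. f p * h p powr (- 1)" "\<lambda>p. f p / h p"] by simp
qed


subsection \<open>Quaternionic triples and the fundamental form\<close>

text \<open>Completes the multiplication table of the imaginary quaternions: each remaining product
  comes from applying a given relation to \<open>J1 v\<close> or \<open>J2 v\<close> and using that
  the squares are -1.\<close>

lemma quaternionic_tripleD:
  assumes "quaternionic_triple h J1 J2 J3"
  shows "linear J1" "linear J2" "linear J3"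
    "J1 (J1 v) = - v" "J2 (J2 v) = - v" "J3 (J3 v) = - v"
    "J1 (J2 v) = J3 v" "J2 (J1 v) = - J3 v"
    "J2 (J3 v) = J1 v" "J3 (J2 v) = - J1 v"
    "J3 (J1 v) = J2 v" "J1 (J3 v) = - J2 v"
proof -
  show lin: "linear J1" "linear J2" "linear J3"
    and sq: "J1 (J1 v) = - v" "J2 (J2 v) = - v" "J3 (J3 v) = - v"
    and 12: "J1 (J2 v) = J3 v" "J2 (J1 v) = - J3 v" for v
    using assms unfolding quaternionic_triple_def by auto
  show "J1 (J3 v) = - J2 v"
    using sq(1)[of "J2 v"] 12(1)[of v] by simp
  show "J2 (J3 v) = J1 v"
    using sq(2)[of "J1 v"] 12(2)[of v] linear_neg[OF lin(2), of "J3 v"] by simp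
  show "J3 (J2 v) = - J1 v"
    using 12(1)[of "J2 v"] sq(2)[of v] linear_neg[OF lin(1), of v] by simp
  show "J3 (J1 v) = J2 v"
    using 12(2)[of "J1 v"] sq(1)[of v] linear_neg[OF lin(2), of v] by simp
qed

text \<open>Different generators anticommute and each squares to -1, so the mixed terms cancel and
  the anticommutator measures the Euclidean inner product of the coefficient vectors.\<close>

lemma anticommutator_endo_span:
  assumes T: "quaternionic_triple h J1 J2 J3"
    and K: "K = (\<lambda>v. a *\<^sub>R J1 v + b *\<^sub>R J2 v + c *\<^sub>R J3 v)"
    and L: "L = (\<lambda>v. a' *\<^sub>R J1 v + b' *\<^sub>R J2 v + c' *\<^sub>R J3 v)"
  shows "K (L v) + L (K v) = - (2 * (a * a' + b * b' + c * c')) *\<^sub>R v"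
proof -
  \<comment> \<open>Splits the factors 2 left by normalisation so that equal vector terms can
    cancel.\<close>
  have double: "(x * (y * 2)) *\<^sub>R v = (x * y) *\<^sub>R v + (x * y) *\<^sub>R v" for x y
    by (simp flip: scaleR_add_left)
  note lin = quaternionic_tripleD(1-3)[OF T]
  show ?thesis
    unfolding K L
    by (simp add: linear_add[OF lin(1)] linear_add[OF lin(2)] linear_add[OF lin(3)]
        linear_scale[OF lin(1)] linear_scale[OF lin(2)] linear_scale[OF lin(3)]
        quaternionic_tripleD[OF T] algebra_simps double)
qed

text \<open>For a square matrix a right inverse is also a left inverse; here the inverse is the
  transpose.\<close>

lemma orthogonal_rows_imp_columns:
  fixes a b c :: "3 \<Rightarrow> real"
  assumes "a 1 * a 1 + b 1 * b 1 + c 1 * c 1 = 1" "a 2 * a 2 + b 2 * b 2 + c 2 * c 2 = 1"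
    "a 3 * a 3 + b 3 * b 3 + c 3 * c 3 = 1"
    "a 1 * a 2 + b 1 * b 2 + c 1 * c 2 = 0" "a 1 * a 3 + b 1 * b 3 + c 1 * c 3 = 0"
    "a 2 * a 3 + b 2 * b 3 + c 2 * c 3 = 0"
  shows "a 1 * a 1 + a 2 * a 2 + a 3 * a 3 = 1" "b 1 * b 1 + b 2 * b 2 + b 3 * b 3 = 1"
    "c 1 * c 1 + c 2 * c 2 + c 3 * c 3 = 1"
    "a 1 * b 1 + a 2 * b 2 + a 3 * b 3 = 0" "a 1 * c 1 + a 2 * c 2 + a 3 * c 3 = 0"
    "b 1 * c 1 + b 2 * c 2 + b 3 * c 3 = 0"
proof -
  define A :: "real^3^3" where "A = (\<chi> i. vector [a i, b i, c i])"
  have "A ** transpose A = mat 1"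
    using assms
    by (simp add: A_def vec_eq_iff forall_3 matrix_matrix_mult_def transpose_def sum_3 mat_def
        mult.commute)
  then have "transpose A ** A = mat 1"
    by (simp add: matrix_left_right_inverse)
  then show "a 1 * a 1 + a 2 * a 2 + a 3 * a 3 = 1" "b 1 * b 1 + b 2 * b 2 + b 3 * b 3 = 1"
    "c 1 * c 1 + c 2 * c 2 + c 3 * c 3 = 1"
    "a 1 * b 1 + a 2 * b 2 + a 3 * b 3 = 0" "a 1 * c 1 + a 2 * c 2 + a 3 * c 3 = 0"
    "b 1 * c 1 + b 2 * c 2 + b 3 * c 3 = 0"
    by (simp_all add: A_def vec_eq_iff forall_3 matrix_matrix_mult_def transpose_def sum_3 mat_def)
qed

text \<open>The coefficient matrix relating the two triples has orthonormal rows because the triples satisfy the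
  same anticommutation relations; its columns are then orthonormal too.\<close>

lemma quaternionic_triple_same_span:
  fixes J1 :: "'a::euclidean_space \<Rightarrow> 'a"
  assumes T: "quaternionic_triple h J1 J2 J3" and T': "quaternionic_triple h K1 K2 K3"
    and span: "endo_span J1 J2 J3 = endo_span K1 K2 K3" and h: "bilinear h"
  shows "two_form h K1 X Y * two_form h K1 Z W + two_form h K2 X Y * two_form h K2 Z W
      + two_form h K3 X Y * two_form h K3 Z W
    = two_form h J1 X Y * two_form h J1 Z W + two_form h J2 X Y * two_form h J2 Z W
      + two_form h J3 X Y * two_form h J3 Z W"
proof -
  \<comment> \<open>Indexing the second triple by the type \<open>3\<close> turns its coefficients
    into the rows of a 3 by 3 matrix.\<close>
  define K where "K i = (if i = (1::3) then K1 else if i = 2 then K2 else K3)" for i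
  have K123: "K 1 = K1" "K 2 = K2" "K 3 = K3"
    by (simp_all add: K_def)
  have "K i \<in> endo_span K1 K2 K3" for i
  proof -
    have "K i = (\<lambda>v. (if i = 1 then 1 else 0) *\<^sub>R K1 v + (if i = 2 then 1 else 0) *\<^sub>R K2 v
      + (if i = 3 then 1 else 0) *\<^sub>R K3 v)"
      using exhaust_3[of i] by (auto simp: K_def)
    then show ?thesis
      unfolding endo_span_def by blast
  qed
  then have "\<exists>a b c. K i = (\<lambda>v. a *\<^sub>R J1 v + b *\<^sub>R J2 v + c *\<^sub>R J3 v)" for i
    unfolding span[symmetric] by (simp add: endo_span_def)
  then obtain a b c where K: "\<And>i. K i = (\<lambda>v. a i *\<^sub>R J1 v + b i *\<^sub>R J2 v + c i *\<^sub>R J3 v)"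
    by metis
  \<comment> \<open>A nonzero vector is needed to pass from equal multiples of v to equal
    scalars.\<close>
  obtain v :: 'a where v: "v \<noteq> 0"
    using nonzero_Basis nonempty_Basis by blast
  have ip: "- (2 * (a i * a j + b i * b j + c i * c j)) *\<^sub>R v = K i (K j v) + K j (K i v)" for i j
    using anticommutator_endo_span[OF T K K] by metis
  have sq: "a i * a i + b i * b i + c i * c i = 1" for i
  proof -
    have "K i (K i v) = - v"
      using exhaust_3[of i] quaternionic_tripleD(4-6)[OF T', of v] by (auto simp: K123)
    then have "- (2 * (a i * a i + b i * b i + c i * c i)) *\<^sub>R v = - 2 *\<^sub>R v"
      unfolding ip by (simp add: scaleR_2)
    then have "- (2 * (a i * a i + b i * b i + c i * c i)) = - 2"
      using v unfolding scaleR_cancel_right by blast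
    then show ?thesis by simp
  qed
  have orth: "a i * a j + b i * b j + c i * c j = 0" if "K i (K j v) + K j (K i v) = 0" for i j
  proof -
    have "- (2 * (a i * a j + b i * b j + c i * c j)) *\<^sub>R v = 0"
      unfolding ip by (rule that)
    then have "- (2 * (a i * a j + b i * b j + c i * c j)) = 0"
      using v unfolding scaleR_eq_0_iff by blast
    then show ?thesis by simp
  qed
  have "a 1 * a 2 + b 1 * b 2 + c 1 * c 2 = 0" "a 1 * a 3 + b 1 * b 3 + c 1 * c 3 = 0"
    "a 2 * a 3 + b 2 * b 3 + c 2 * c 3 = 0"
    by (rule orth, unfold K123, simp add: quaternionic_tripleD[OF T'])+
  note R = orthogonal_rows_imp_columns[of a b c, OF sq sq sq this]
  have F: "two_form h (K i) X Y
    = a i * two_form h J1 X Y + b i * two_form h J2 X Y + c i * two_form h J3 X Y" for i X Y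
    unfolding two_form_def K by (simp add: bilinear_ladd[OF h] bilinear_lmul[OF h])
  \<comment> \<open>Expanding in the first triple, the coefficients are the inner products of the
    columns, so they become 1 and 0.\<close>
  have "two_form h K1 X Y * two_form h K1 Z W + two_form h K2 X Y * two_form h K2 Z W
      + two_form h K3 X Y * two_form h K3 Z W
    = (a 1 * a 1 + a 2 * a 2 + a 3 * a 3) * (two_form h J1 X Y * two_form h J1 Z W)
    + (b 1 * b 1 + b 2 * b 2 + b 3 * b 3) * (two_form h J2 X Y * two_form h J2 Z W)
    + (c 1 * c 1 + c 2 * c 2 + c 3 * c 3) * (two_form h J3 X Y * two_form h J3 Z W)
    + (a 1 * b 1 + a 2 * b 2 + a 3 * b 3) * (two_form h J1 X Y * two_form h J2 Z W + two_form h J2 X Y * two_form h J1 Z W)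
    + (a 1 * c 1 + a 2 * c 2 + a 3 * c 3) * (two_form h J1 X Y * two_form h J3 Z W + two_form h J3 X Y * two_form h J1 Z W)
    + (b 1 * c 1 + b 2 * c 2 + b 3 * c 3) * (two_form h J2 X Y * two_form h J3 Z W + two_form h J3 X Y * two_form h J2 Z W)"
    unfolding F[of 1, unfolded K123] F[of 2, unfolded K123] F[of 3, unfolded K123]
    by (simp add: algebra_simps)
  then show ?thesis unfolding R by simp
qed

lemma wedge22_self:
  "wedge22 \<alpha> \<alpha> X Y Z W = 2 * (\<alpha> X Y * \<alpha> Z W) - 2 * (\<alpha> X Z * \<alpha> Y W) + 2 * (\<alpha> X W * \<alpha> Y Z)"
  unfolding wedge22_def by simp

text \<open>Evaluates the definite description. By \<open>wedge22_self\<close> the form depends only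
  on the sums of products of 2-forms that a change of triple preserves, taken over the three ways of
  pairing four arguments.\<close>

lemma fundamental_form_eq:
  assumes T: "quaternionic_triple (g p) J1 J2 J3" and Q: "Q p = endo_span J1 J2 J3"
    and g: "bilinear (g p)"
  shows "fundamental_form g Q p X Y Z W =
    wedge22 (two_form (g p) J1) (two_form (g p) J1) X Y Z W
    + wedge22 (two_form (g p) J2) (two_form (g p) J2) X Y Z W
    + wedge22 (two_form (g p) J3) (two_form (g p) J3) X Y Z W"
proof -
  define \<Phi> where "\<Phi> K1 K2 K3 = (\<lambda>X Y Z W. \<Sum>J\<leftarrow>[K1, K2, K3].
            wedge22 (two_form (g p) J) (two_form (g p) J) X Y Z W)" for K1 K2 K3
  have "\<Phi> K1 K2 K3 = \<Phi> J1 J2 J3"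
    if K: "quaternionic_triple (g p) K1 K2 K3" "Q p = endo_span K1 K2 K3" for K1 K2 K3
  proof (intro ext)
    fix X Y Z W
    show "\<Phi> K1 K2 K3 X Y Z W = \<Phi> J1 J2 J3 X Y Z W"
      using quaternionic_triple_same_span[OF T K(1) K(2)[unfolded Q] g, of X Y Z W]
        quaternionic_triple_same_span[OF T K(1) K(2)[unfolded Q] g, of X Z Y W]
        quaternionic_triple_same_span[OF T K(1) K(2)[unfolded Q] g, of X W Y Z]
      unfolding \<Phi>_def list.map sum_list.Cons sum_list.Nil wedge22_self by linarith
  qed
  then have "fundamental_form g Q p = \<Phi> J1 J2 J3"
    unfolding fundamental_form_def \<Phi>_def[symmetric] using T Q by (intro the_equality) metis+
  then show ?thesis by (simp add: \<Phi>_def)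
qed

subsection \<open>The Koszul formula\<close>

text \<open>Riesz representation for h: T turns h w into a vector through the Euclidean inner
  product. Positivity makes T injective, and equal dimensions make it surjective.\<close>

lemma inner_product_riesz:
  fixes h :: "'a::euclidean_space \<Rightarrow> 'a \<Rightarrow> real"
  assumes h: "bilinear h" and pos: "\<And>v. v \<noteq> 0 \<Longrightarrow> h v v > 0" and L: "linear L"
  shows "\<exists>w. \<forall>z. h w z = L z"
proof -
  define T where "T w = (\<Sum>b\<in>Basis. h w b *\<^sub>R b)" for w
  have T: "linear T"
    unfolding T_def
    by (intro linearI) (simp_all add: bilinear_ladd[OF h] bilinear_lmul[OF h] scaleR_add_left
        sum.distrib scaleR_sum_right)
  have inner_T: "T w \<bullet> z = h w z" for w z
  proof -
    have "h w z = h w (\<Sum>b\<in>Basis. (z \<bullet> b) *\<^sub>R b)"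
      by (simp add: euclidean_representation)
    also have "\<dots> = (\<Sum>b\<in>Basis. (z \<bullet> b) * h w b)"
      using h by (simp add: bilinear_def linear_sum linear_scale)
    finally show ?thesis
      by (simp add: T_def inner_sum_left inner_commute[of z] mult.commute)
  qed
  have "inj T"
    unfolding linear_injective_0[OF T] using inner_T pos
    by (metis inner_zero_left less_irrefl)
  then have "surj T" using linear_injective_imp_surjective[OF T] by simp
  then obtain w where w: "T w = (\<Sum>b\<in>Basis. L b *\<^sub>R b)" by (metis surjD)
  have "h w z = L z" for z
  proof -
    have "L z = L (\<Sum>b\<in>Basis. (z \<bullet> b) *\<^sub>R b)"
      by (simp add: euclidean_representation)
    also have "\<dots> = (\<Sum>b\<in>Basis. (z \<bullet> b) * L b)"
      using L by (simp add: linear_sum linear_scale)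
    finally show ?thesis
      using inner_T[of w z] by (simp add: w inner_sum_left inner_commute[of z] mult.commute)
  qed
  then show ?thesis by blast
qed

lemma nondegenerate_eqI:
  assumes h: "bilinear h" and pos: "\<And>v. v \<noteq> 0 \<Longrightarrow> h v v > (0::real)" and eq: "\<And>z. h v z = h w z"
  shows "v = w"
  using pos[of "v - w"] eq[of "v - w"] bilinear_lsub[OF h, of v w "v - w"] by force

text \<open>The Koszul expression is linear in Z, so Riesz yields a connection, which is then shown
  to be the only one meeting the defining conditions. The fields are constant, so no bracket terms
  occur.\<close>

lemma koszul_levi_civita:
  fixes g :: "'a::euclidean_space \<Rightarrow> 'a \<Rightarrow> 'a \<Rightarrow> real"
  assumes g: "riemannian_metric_on M g" and "open M" "p \<in> M"
  shows "2 * g p (levi_civita g p X Y) Z =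
    dir_deriv (\<lambda>q. g q Y Z) p X + dir_deriv (\<lambda>q. g q X Z) p Y - dir_deriv (\<lambda>q. g q X Y) p Z"
proof -
  define D where "D X Y Z = dir_deriv (\<lambda>q. g q Y Z) p X" for X Y Z
  have bil: "bilinear (g q)" and sym: "g q v w = g q w v" and pos: "v \<noteq> 0 \<Longrightarrow> g q v v > 0"
    if "q \<in> M" for q v w
    using g that unfolding riemannian_metric_on_def by auto
  have hd: "((\<lambda>q. g q Y Z) has_derivative (\<lambda>X. D X Y Z)) (at p)" for Y Z
    using g \<open>p \<in> M\<close> unfolding riemannian_metric_on_def D_def
    by (auto intro: has_derivative_dir_deriv[unfolded eta_contract_eq] smooth_on_imp_differentiable)
  have D1: "linear (\<lambda>X. D X Y Z)" for Y Z
    using hd has_derivative_linear by blast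
  have Dsym: "D X Y Z = D X Z Y" for X Y Z
    unfolding D_def by (rule dir_deriv_cong[OF assms(2,3)]) (rule sym)
  \<comment> \<open>Bilinearity of the metric is available on M only, hence the passage through
    \<open>dir_deriv_cong\<close>.\<close>
  have Dadd: "D X (Y + Y') Z = D X Y Z + D X Y' Z" for X Y Y' Z
  proof -
    have "D X (Y + Y') Z = dir_deriv (\<lambda>q. g q Y Z + g q Y' Z) p X"
      unfolding D_def by (rule dir_deriv_cong[OF assms(2,3)]) (simp add: bilinear_ladd[OF bil])
    also have "\<dots> = D X Y Z + D X Y' Z"
      by (rule dir_deriv_eq) (intro has_derivative_add hd)
    finally show ?thesis .
  qed
  have Dmul: "D X (c *\<^sub>R Y) Z = c * D X Y Z" for X Y Z c
  proof -
    have "D X (c *\<^sub>R Y) Z = dir_deriv (\<lambda>q. c * g q Y Z) p X"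
      unfolding D_def by (rule dir_deriv_cong[OF assms(2,3)]) (simp add: bilinear_lmul[OF bil])
    also have "\<dots> = c * D X Y Z"
      by (rule dir_deriv_eq) (intro has_derivative_mult_right hd)
    finally show ?thesis .
  qed
  have Dadd': "D X Z (Y + Y') = D X Z Y + D X Z Y'" and Dmul': "D X Z (c *\<^sub>R Y) = c * D X Z Y"
    for X Y Y' Z c
    using Dadd Dmul Dsym by metis+
  note Dlin = linear_add[OF D1] linear_scale[OF D1, unfolded real_scaleR_def] Dadd Dmul Dadd' Dmul'
  define L where "L X Y Z = (D X Y Z + D Y X Z - D Z X Y) / 2" for X Y Z
  have Lin: "linear (L X Y)" for X Y
    by (intro linearI) (simp_all add: L_def Dlin field_simps)
  define \<Gamma> where "\<Gamma> X Y = (SOME w. \<forall>z. g p w z = L X Y z)" for X Y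
  have \<Gamma>: "g p (\<Gamma> X Y) z = L X Y z" for X Y z
    using someI_ex[OF inner_product_riesz[OF bil pos Lin]] \<open>p \<in> M\<close> unfolding \<Gamma>_def by blast
  have eqI: "v = w" if "\<And>z. g p v z = g p w z" for v w
    using nondegenerate_eqI[of "g p" v w] that bil pos \<open>p \<in> M\<close> by blast
  note bp = bil[OF \<open>p \<in> M\<close>]
  have bilG: "bilinear \<Gamma>"
    unfolding bilinear_def
    by (intro conjI allI linearI; rule eqI)
      (simp_all add: bilinear_ladd[OF bp] bilinear_lmul[OF bp] \<Gamma>, simp_all add: L_def Dlin field_simps)
  have symG: "\<Gamma> X Y = \<Gamma> Y X" for X Y
    by (rule eqI) (simp add: \<Gamma> L_def Dsym[of _ X Y])
  have metG: "D X Y Z = g p (\<Gamma> X Y) Z + g p Y (\<Gamma> X Z)" for X Y Z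
    by (simp add: sym[OF \<open>p \<in> M\<close>, of Y] \<Gamma> L_def Dsym[of _ Z Y] Dsym[of _ Z X] Dsym[of _ Y X] field_simps)
  have "levi_civita g p = \<Gamma>"
    unfolding levi_civita_def D_def[symmetric]
  proof (rule the_equality)
    show "bilinear \<Gamma> \<and> (\<forall>X Y. \<Gamma> X Y = \<Gamma> Y X) \<and> (\<forall>X Y Z. D X Y Z = g p (\<Gamma> X Y) Z + g p Y (\<Gamma> X Z))"
      using bilG symG metG by blast
    fix G
    assume G: "bilinear G \<and> (\<forall>X Y. G X Y = G Y X) \<and> (\<forall>X Y Z. D X Y Z = g p (G X Y) Z + g p Y (G X Z))"
    \<comment> \<open>Uniqueness by Koszul's trick: add two cyclic copies of metric compatibility,
      subtract the third, and cancel by symmetry of G and g.\<close>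
    have "g p (G X Y) z = L X Y z" for X Y z
    proof -
      have "D X Y z = g p (G X Y) z + g p Y (G X z)" "D Y X z = g p (G Y X) z + g p X (G Y z)"
        "D z X Y = g p (G z X) Y + g p X (G z Y)" "G Y X = G X Y" "G z X = G X z" "G z Y = G Y z"
        using G by blast+
      moreover have "g p Y (G X z) = g p (G X z) Y" using sym \<open>p \<in> M\<close> by blast
      ultimately show ?thesis by (simp add: L_def)
    qed
    then show "G = \<Gamma>"
      by (intro ext eqI) (simp add: \<Gamma>)
  qed
  then show ?thesis
    by (simp add: \<Gamma> L_def D_def)
qed

text \<open>Reduces the computation of a Christoffel symbol to checking a guessed vector against the
  Koszul formula.\<close>

lemma levi_civita_eqI:
  fixes g :: "'a::euclidean_space \<Rightarrow> 'a \<Rightarrow> 'a \<Rightarrow> real"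
  assumes g: "riemannian_metric_on M g" and M: "open M" "p \<in> M"
    and "\<And>Z. 2 * g p V Z =
      dir_deriv (\<lambda>q. g q Y Z) p X + dir_deriv (\<lambda>q. g q X Z) p Y - dir_deriv (\<lambda>q. g q X Y) p Z"
  shows "levi_civita g p X Y = V"
proof (rule nondegenerate_eqI[of "g p"])
  show "bilinear (g p)" "\<And>v. v \<noteq> 0 \<Longrightarrow> 0 < g p v v"
    using g M(2) unfolding riemannian_metric_on_def by auto
  show "g p (levi_civita g p X Y) z = g p V z" for z
    using koszul_levi_civita[OF g M, of X Y z] assms(4)[of z] by simp
qed


subsection \<open>Exterior algebra\<close>

text \<open>The wedge products of forms of degree \<open>m\<close> and \<open>n\<close> are sums over \<open>(m, n)\<close>-shuffles. Antisymmetry of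
  the factors is not built in, so the algebraic rules below hold for arbitrary functions.\<close>

definition wedge11 :: "('a \<Rightarrow> real) \<Rightarrow> ('a \<Rightarrow> real) \<Rightarrow> 'a \<Rightarrow> 'a \<Rightarrow> real" where
  "wedge11 \<alpha> \<beta> X Y = \<alpha> X * \<beta> Y - \<alpha> Y * \<beta> X"

definition wedge12 :: "('a \<Rightarrow> real) \<Rightarrow> ('a \<Rightarrow> 'a \<Rightarrow> real) \<Rightarrow> 'a \<Rightarrow> 'a \<Rightarrow> 'a \<Rightarrow> real" where
  "wedge12 \<alpha> \<beta> X Y Z = \<alpha> X * \<beta> Y Z - \<alpha> Y * \<beta> X Z + \<alpha> Z * \<beta> X Y"

definition wedge14 ::
  "('a \<Rightarrow> real) \<Rightarrow> ('a \<Rightarrow> 'a \<Rightarrow> 'a \<Rightarrow> 'a \<Rightarrow> real) \<Rightarrow> 'a \<Rightarrow> 'a \<Rightarrow> 'a \<Rightarrow> 'a \<Rightarrow> 'a \<Rightarrow> real" where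
  "wedge14 \<alpha> \<beta> V X Y Z W =
     \<alpha> V * \<beta> X Y Z W - \<alpha> X * \<beta> V Y Z W + \<alpha> Y * \<beta> V X Z W - \<alpha> Z * \<beta> V X Y W + \<alpha> W * \<beta> V X Y Z"

definition wedge32 ::
  "('a \<Rightarrow> 'a \<Rightarrow> 'a \<Rightarrow> real) \<Rightarrow> ('a \<Rightarrow> 'a \<Rightarrow> real) \<Rightarrow> 'a \<Rightarrow> 'a \<Rightarrow> 'a \<Rightarrow> 'a \<Rightarrow> 'a \<Rightarrow> real" where
  "wedge32 \<alpha> \<beta> V X Y Z W =
     \<alpha> V X Y * \<beta> Z W - \<alpha> V X Z * \<beta> Y W + \<alpha> V X W * \<beta> Y Z + \<alpha> V Y Z * \<beta> X W
     - \<alpha> V Y W * \<beta> X Z + \<alpha> V Z W * \<beta> X Y - \<alpha> X Y Z * \<beta> V W + \<alpha> X Y W * \<beta> V Z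
     - \<alpha> X Z W * \<beta> V Y + \<alpha> Y Z W * \<beta> V X"

definition ext_deriv2 ::
  "('a::euclidean_space \<Rightarrow> 'a \<Rightarrow> 'a \<Rightarrow> real) \<Rightarrow> 'a \<Rightarrow> 'a \<Rightarrow> 'a \<Rightarrow> 'a \<Rightarrow> real" where
  "ext_deriv2 \<omega> p X Y Z =
     dir_deriv (\<lambda>q. \<omega> q Y Z) p X - dir_deriv (\<lambda>q. \<omega> q X Z) p Y + dir_deriv (\<lambda>q. \<omega> q X Y) p Z"

lemma dir_deriv_wedge22_self:
  assumes "\<And>X Y. (\<lambda>q. F q X Y) differentiable (at p)"
  shows "dir_deriv (\<lambda>q. wedge22 (F q) (F q) X Y Z W) p V = 2 *
     (dir_deriv (\<lambda>q. F q X Y) p V * F p Z W + F p X Y * dir_deriv (\<lambda>q. F q Z W) p V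
      - dir_deriv (\<lambda>q. F q X Z) p V * F p Y W - F p X Z * dir_deriv (\<lambda>q. F q Y W) p V
      + dir_deriv (\<lambda>q. F q X W) p V * F p Y Z + F p X W * dir_deriv (\<lambda>q. F q Y Z) p V)"
proof -
  note d = has_derivative_dir_deriv[OF assms]
  have "((\<lambda>q. wedge22 (F q) (F q) X Y Z W) has_derivative (\<lambda>V. 2 *
     (dir_deriv (\<lambda>q. F q X Y) p V * F p Z W + F p X Y * dir_deriv (\<lambda>q. F q Z W) p V
      - dir_deriv (\<lambda>q. F q X Z) p V * F p Y W - F p X Z * dir_deriv (\<lambda>q. F q Y W) p V
      + dir_deriv (\<lambda>q. F q X W) p V * F p Y Z + F p X W * dir_deriv (\<lambda>q. F q Y Z) p V))) (at p)"
    unfolding wedge22_self by (auto intro!: derivative_eq_intros d simp: algebra_simps)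
  then show ?thesis by (rule dir_deriv_eq)
qed

lemma differentiable_wedge22_self:
  assumes "\<And>X Y. (\<lambda>q. F q X Y) differentiable (at p)"
  shows "(\<lambda>q. wedge22 (F q) (F q) X Y Z W) differentiable (at p)"
  unfolding wedge22_self by (intro derivative_intros assms)

text \<open>The Leibniz rule; the factor 2 appears because 2-forms commute under the wedge
  product.\<close>

lemma ext_deriv4_wedge22_self:
  assumes "\<And>X Y. (\<lambda>q. F q X Y) differentiable (at p)"
  shows "ext_deriv4 (\<lambda>q. wedge22 (F q) (F q)) p V X Y Z W =
    2 * wedge32 (ext_deriv2 F p) (F p) V X Y Z W"
  unfolding ext_deriv4_def dir_deriv_wedge22_self[OF assms]
  by (simp add: wedge32_def ext_deriv2_def algebra_simps)

lemma ext_deriv4_add: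
  assumes "\<And>X Y Z W. (\<lambda>q. \<phi> q X Y Z W) differentiable (at p)"
    and "\<And>X Y Z W. (\<lambda>q. \<psi> q X Y Z W) differentiable (at p)"
  shows "ext_deriv4 (\<lambda>q X Y Z W. \<phi> q X Y Z W + \<psi> q X Y Z W) p V X Y Z W =
    ext_deriv4 \<phi> p V X Y Z W + ext_deriv4 \<psi> p V X Y Z W"
proof -
  have "dir_deriv (\<lambda>q. \<phi> q X Y Z W + \<psi> q X Y Z W) p V =
    dir_deriv (\<lambda>q. \<phi> q X Y Z W) p V + dir_deriv (\<lambda>q. \<psi> q X Y Z W) p V" for V X Y Z W
    by (rule dir_deriv_eq) (intro has_derivative_add has_derivative_dir_deriv assms)
  then show ?thesis by (simp add: ext_deriv4_def)
qed

lemma wedge32_linear: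
  "wedge32 (\<lambda>X Y Z. \<alpha> X Y Z + \<alpha>' X Y Z) \<beta> V X Y Z W = wedge32 \<alpha> \<beta> V X Y Z W + wedge32 \<alpha>' \<beta> V X Y Z W"
  "wedge32 (\<lambda>X Y Z. \<alpha> X Y Z - \<alpha>' X Y Z) \<beta> V X Y Z W = wedge32 \<alpha> \<beta> V X Y Z W - wedge32 \<alpha>' \<beta> V X Y Z W"
  "wedge32 (\<lambda>X Y Z. c * \<alpha> X Y Z) \<beta> V X Y Z W = c * wedge32 \<alpha> \<beta> V X Y Z W"
  "wedge32 \<alpha> (\<lambda>X Y. \<beta> X Y + \<beta>' X Y) V X Y Z W = wedge32 \<alpha> \<beta> V X Y Z W + wedge32 \<alpha> \<beta>' V X Y Z W"
  "wedge32 \<alpha> (\<lambda>X Y. \<beta> X Y - \<beta>' X Y) V X Y Z W = wedge32 \<alpha> \<beta> V X Y Z W - wedge32 \<alpha> \<beta>' V X Y Z W"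
  "wedge32 \<alpha> (\<lambda>X Y. c * \<beta> X Y) V X Y Z W = c * wedge32 \<alpha> \<beta> V X Y Z W"
  by (simp_all add: wedge32_def algebra_simps)

text \<open>Associativity of the wedge product for a 1-form and two 2-forms.\<close>

lemma wedge32_wedge12:
  "wedge32 (wedge12 \<alpha> \<sigma>) \<beta> V X Y Z W = wedge14 \<alpha> (wedge22 \<sigma> \<beta>) V X Y Z W"
  by (simp add: wedge32_def wedge14_def wedge12_def wedge22_def algebra_simps)

lemma wedge22_commute: "wedge22 \<alpha> \<beta> = wedge22 \<beta> \<alpha>"
  by (intro ext) (simp add: wedge22_def algebra_simps)

lemma wedge22_decomposable: "wedge22 (wedge11 \<alpha> \<beta>) (wedge11 \<alpha> \<beta>) X Y Z W = 0"
  by (simp add: wedge22_def wedge11_def algebra_simps)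

text \<open>Together with the swap rule below, this brings every surviving 5-form to a normal form
  starting with du.\<close>

lemma wedge14_wedge22_rotate:
  "wedge14 \<alpha> (wedge22 \<sigma> (wedge11 \<beta> \<gamma>)) V X Y Z W = wedge14 \<beta> (wedge22 \<sigma> (wedge11 \<gamma> \<alpha>)) V X Y Z W"
  by (simp add: wedge14_def wedge22_def wedge11_def algebra_simps)

lemma wedge14_wedge22_swap:
  "wedge14 \<alpha> (wedge22 \<sigma> (wedge11 \<beta> \<gamma>)) V X Y Z W = - wedge14 \<alpha> (wedge22 \<sigma> (wedge11 \<gamma> \<beta>)) V X Y Z W"
  by (simp add: wedge14_def wedge22_def wedge11_def algebra_simps)

lemma wedge14_wedge22_repeated:
  "wedge14 \<alpha> (wedge22 \<sigma> (wedge11 \<alpha> \<beta>)) V X Y Z W = 0"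
  "wedge14 \<alpha> (wedge22 \<sigma> (wedge11 \<beta> \<alpha>)) V X Y Z W = 0"
  "wedge14 \<alpha> (wedge22 (wedge11 \<alpha> \<beta>) \<sigma>) V X Y Z W = 0"
  "wedge14 \<alpha> (wedge22 (wedge11 \<beta> \<alpha>) \<sigma>) V X Y Z W = 0"
  by (simp_all add: wedge14_def wedge22_def wedge11_def algebra_simps)

text \<open>One computation for all three 2-forms. The coefficients vary only along \<tau>, while
  \<sigma> and \<tau> are constant, hence closed; the term with D' contains \<tau> twice and
  vanishes. Antisymmetrising \<alpha>' gives the exterior derivative of \<alpha>, likewise for
  \<beta> and \<gamma>.\<close>

lemma ext_deriv2_coframe:
  assumes F: "\<And>q X Y. F q X Y = A q * \<sigma> X Y + B q * wedge11 (\<alpha> q) (\<beta> q) X Y - D q * wedge11 (\<gamma> q) \<tau> X Y"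
    and A: "(A has_derivative (\<lambda>V. A' * \<tau> V)) (at p)"
    and B: "(B has_derivative (\<lambda>V. B' * \<tau> V)) (at p)"
    and D: "(D has_derivative (\<lambda>V. D' * \<tau> V)) (at p)"
    and \<alpha>: "\<And>X. ((\<lambda>q. \<alpha> q X) has_derivative (\<lambda>V. \<alpha>' V X)) (at p)"
    and \<beta>: "\<And>X. ((\<lambda>q. \<beta> q X) has_derivative (\<lambda>V. \<beta>' V X)) (at p)"
    and \<gamma>: "\<And>X. ((\<lambda>q. \<gamma> q X) has_derivative (\<lambda>V. \<gamma>' V X)) (at p)"
  shows "((\<lambda>q. F q X Y) has_derivative (\<lambda>V. A' * \<tau> V * \<sigma> X Y + B' * \<tau> V * wedge11 (\<alpha> p) (\<beta> p) X Y
      + B p * (\<alpha>' V X * \<beta> p Y + \<alpha> p X * \<beta>' V Y - \<alpha>' V Y * \<beta> p X - \<alpha> p Y * \<beta>' V X)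
      - D' * \<tau> V * wedge11 (\<gamma> p) \<tau> X Y - D p * (\<gamma>' V X * \<tau> Y - \<gamma>' V Y * \<tau> X))) (at p)"
    (is "(_ has_derivative ?F' X Y) _")
  and "ext_deriv2 F p X Y Z = A' * wedge12 \<tau> \<sigma> X Y Z + B' * wedge12 \<tau> (wedge11 (\<alpha> p) (\<beta> p)) X Y Z
      + B p * (wedge12 (\<beta> p) (\<lambda>X Y. \<alpha>' X Y - \<alpha>' Y X) X Y Z - wedge12 (\<alpha> p) (\<lambda>X Y. \<beta>' X Y - \<beta>' Y X) X Y Z)
      - D p * wedge12 \<tau> (\<lambda>X Y. \<gamma>' X Y - \<gamma>' Y X) X Y Z"
proof -
  show F': "((\<lambda>q. F q X Y) has_derivative ?F' X Y) (at p)" for X Y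
    unfolding F wedge11_def
    by (rule derivative_eq_intros A B D \<alpha> \<beta> \<gamma> refl)+ (simp add: fun_eq_iff algebra_simps)
  show "ext_deriv2 F p X Y Z = A' * wedge12 \<tau> \<sigma> X Y Z + B' * wedge12 \<tau> (wedge11 (\<alpha> p) (\<beta> p)) X Y Z
      + B p * (wedge12 (\<beta> p) (\<lambda>X Y. \<alpha>' X Y - \<alpha>' Y X) X Y Z - wedge12 (\<alpha> p) (\<lambda>X Y. \<beta>' X Y - \<beta>' Y X) X Y Z)
      - D p * wedge12 \<tau> (\<lambda>X Y. \<gamma>' X Y - \<gamma>' Y X) X Y Z"
    unfolding ext_deriv2_def dir_deriv_eq[OF F'] wedge12_def wedge11_def
    by (simp add: algebra_simps)
qed


subsection \<open>The quaternionic Heisenberg coframe and the metric\<close>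

lemma exhaust_7: "(x::7) = 1 \<or> x = 2 \<or> x = 3 \<or> x = 4 \<or> x = 5 \<or> x = 6 \<or> x = 7"
proof (induct x)
  case (of_int z)
  then have "z = 0 \<or> z = 1 \<or> z = 2 \<or> z = 3 \<or> z = 4 \<or> z = 5 \<or> z = 6" by auto
  then show ?case by auto
qed

lemma forall_7: "(\<forall>i::7. P i) \<longleftrightarrow> P 1 \<and> P 2 \<and> P 3 \<and> P 4 \<and> P 5 \<and> P 6 \<and> P 7"
  by (metis exhaust_7)

type_synonym heis_space = "(real^7) \<times> real"

definition e :: "7 \<Rightarrow> heis_space \<Rightarrow> real" where "e i X = fst X $ i"
definition \<eta>1 :: "heis_space \<Rightarrow> heis_space \<Rightarrow> real" where "\<eta>1 p X = eta1 (fst p) (fst X)"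
definition \<eta>2 :: "heis_space \<Rightarrow> heis_space \<Rightarrow> real" where "\<eta>2 p X = eta2 (fst p) (fst X)"
definition \<eta>3 :: "heis_space \<Rightarrow> heis_space \<Rightarrow> real" where "\<eta>3 p X = eta3 (fst p) (fst X)"

lemmas coframe_defs = e_def \<eta>1_def \<eta>2_def \<eta>3_def eta1_def eta2_def eta3_def

lemma coframe_linear:
  "e i (X + Y) = e i X + e i Y" "e i (c *\<^sub>R X) = c * e i X" "e i (- X) = - e i X"
  "\<eta>1 p (X + Y) = \<eta>1 p X + \<eta>1 p Y" "\<eta>1 p (c *\<^sub>R X) = c * \<eta>1 p X" "\<eta>1 p (- X) = - \<eta>1 p X"
  "\<eta>2 p (X + Y) = \<eta>2 p X + \<eta>2 p Y" "\<eta>2 p (c *\<^sub>R X) = c * \<eta>2 p X" "\<eta>2 p (- X) = - \<eta>2 p X"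
  "\<eta>3 p (X + Y) = \<eta>3 p X + \<eta>3 p Y" "\<eta>3 p (c *\<^sub>R X) = c * \<eta>3 p X" "\<eta>3 p (- X) = - \<eta>3 p X"
  by (simp_all add: coframe_defs algebra_simps)

text \<open>The eight forms are a coframe at every point, so vector identities can be checked on
  components in which the metric is diagonal.\<close>

lemma coframe_eqI:
  assumes "e 1 X = e 1 Y" "e 2 X = e 2 Y" "e 3 X = e 3 Y" "e 4 X = e 4 Y"
    "\<eta>1 p X = \<eta>1 p Y" "\<eta>2 p X = \<eta>2 p Y" "\<eta>3 p X = \<eta>3 p Y" "snd X = snd Y"
  shows "X = Y"
  using assms by (simp add: coframe_defs prod_eq_iff vec_eq_iff forall_7)

text \<open>The vector with prescribed values \<open>y\<^sub>i\<close>, \<open>z\<^sub>s\<close>, \<open>s\<close> of \<open>e\<^sub>i\<close>, \<open>\<eta>\<^sub>s\<close>, \<open>du\<close> at \<open>p\<close>.\<close>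

definition coframe_vec ::
  "heis_space \<Rightarrow> real \<Rightarrow> real \<Rightarrow> real \<Rightarrow> real \<Rightarrow> real \<Rightarrow> real \<Rightarrow> real \<Rightarrow> real \<Rightarrow> heis_space" where
  "coframe_vec p y1 y2 y3 y4 z1 z2 z3 s =
     y1 *\<^sub>R (axis 1 1, 0) + y2 *\<^sub>R (axis 2 1, 0) + y3 *\<^sub>R (axis 3 1, 0) + y4 *\<^sub>R (axis 4 1, 0)
     + (z1 + - 2 * (e 1 p * y2) + - 2 * (e 3 p * y4)) *\<^sub>R (axis 5 1, 0)
     + (z2 + - 2 * (e 1 p * y3) + - 2 * (e 4 p * y2)) *\<^sub>R (axis 6 1, 0)
     + (z3 + - 2 * (e 1 p * y4) + - 2 * (e 2 p * y3)) *\<^sub>R (axis 7 1, 0)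
     + s *\<^sub>R (0, 1)"

lemma coframe_vec_simps:
  "e 1 (coframe_vec p y1 y2 y3 y4 z1 z2 z3 s) = y1"
  "e 2 (coframe_vec p y1 y2 y3 y4 z1 z2 z3 s) = y2"
  "e 3 (coframe_vec p y1 y2 y3 y4 z1 z2 z3 s) = y3"
  "e 4 (coframe_vec p y1 y2 y3 y4 z1 z2 z3 s) = y4"
  "\<eta>1 p (coframe_vec p y1 y2 y3 y4 z1 z2 z3 s) = z1"
  "\<eta>2 p (coframe_vec p y1 y2 y3 y4 z1 z2 z3 s) = z2"
  "\<eta>3 p (coframe_vec p y1 y2 y3 y4 z1 z2 z3 s) = z3"
  "snd (coframe_vec p y1 y2 y3 y4 z1 z2 z3 s) = s"
  by (simp_all add: coframe_vec_def coframe_defs axis_def)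

lemma bounded_linear_e: "bounded_linear (e i)"
  unfolding e_def by (intro bounded_linear_compose[OF bounded_linear_vec_nth] bounded_linear_fst)

lemma smooth_on_coframe_vec:
  assumes "open S" "smooth_on S y1" "smooth_on S y2" "smooth_on S y3" "smooth_on S y4"
    "smooth_on S z1" "smooth_on S z2" "smooth_on S z3" "smooth_on S s"
  shows "smooth_on S (\<lambda>p. coframe_vec p (y1 p) (y2 p) (y3 p) (y4 p) (z1 p) (z2 p) (z3 p) (s p))"
  unfolding coframe_vec_def
  by (intro smooth_on_add smooth_on_scaleR smooth_on_mult smooth_on_const assms
      smooth_on_bounded_linear bounded_linear_e)

lemma smooth_on_\<eta>:
  assumes "open S"
  shows "smooth_on S (\<lambda>p. \<eta>1 p X)" "smooth_on S (\<lambda>p. \<eta>2 p X)" "smooth_on S (\<lambda>p. \<eta>3 p X)"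
  unfolding coframe_defs
  by (intro smooth_on_add smooth_on_mult smooth_on_const assms
      smooth_on_bounded_linear[OF _ bounded_linear_e[unfolded e_def]])+

lemma has_derivative_\<eta>:
  "((\<lambda>p. \<eta>1 p X) has_derivative (\<lambda>V. 2 * e 1 V * e 2 X + 2 * e 3 V * e 4 X)) (at p)"
  "((\<lambda>p. \<eta>2 p X) has_derivative (\<lambda>V. 2 * e 1 V * e 3 X + 2 * e 4 V * e 2 X)) (at p)"
  "((\<lambda>p. \<eta>3 p X) has_derivative (\<lambda>V. 2 * e 1 V * e 4 X + 2 * e 2 V * e 3 X)) (at p)"
  using bounded_linear_imp_has_derivative[OF bounded_linear_e, of _ "at p"] unfolding coframe_defs
  by (auto intro!: derivative_eq_intros)

definition \<sigma>1 :: "heis_space \<Rightarrow> heis_space \<Rightarrow> real" where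
  "\<sigma>1 X Y = wedge11 (e 1) (e 2) X Y + wedge11 (e 3) (e 4) X Y"
definition \<sigma>2 :: "heis_space \<Rightarrow> heis_space \<Rightarrow> real" where
  "\<sigma>2 X Y = wedge11 (e 1) (e 3) X Y + wedge11 (e 4) (e 2) X Y"
definition \<sigma>3 :: "heis_space \<Rightarrow> heis_space \<Rightarrow> real" where
  "\<sigma>3 X Y = wedge11 (e 1) (e 4) X Y + wedge11 (e 2) (e 3) X Y"

text \<open>These are the standard self-dual 2-forms on the four horizontal directions: pairwise
  orthogonal and of equal length.\<close>

lemma wedge22_\<sigma>:
  "wedge22 \<sigma>1 \<sigma>2 = (\<lambda>X Y Z W. 0)" "wedge22 \<sigma>1 \<sigma>3 = (\<lambda>X Y Z W. 0)" "wedge22 \<sigma>2 \<sigma>3 = (\<lambda>X Y Z W. 0)"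
  "wedge22 \<sigma>2 \<sigma>1 = (\<lambda>X Y Z W. 0)" "wedge22 \<sigma>3 \<sigma>1 = (\<lambda>X Y Z W. 0)" "wedge22 \<sigma>3 \<sigma>2 = (\<lambda>X Y Z W. 0)"
  "wedge22 \<sigma>2 \<sigma>2 = wedge22 \<sigma>1 \<sigma>1" "wedge22 \<sigma>3 \<sigma>3 = wedge22 \<sigma>1 \<sigma>1"
  by (intro ext, simp add: wedge22_def \<sigma>1_def \<sigma>2_def \<sigma>3_def wedge11_def algebra_simps)+

text \<open>The antisymmetrised derivatives of \<open>has_derivative_\<eta>\<close>, that is, the
  structure equations of the group.\<close>

lemma d\<eta>:
  "(\<lambda>V X. 2 * e 1 V * e 2 X + 2 * e 3 V * e 4 X - (2 * e 1 X * e 2 V + 2 * e 3 X * e 4 V))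
    = (\<lambda>V X. 2 * \<sigma>1 V X)"
  "(\<lambda>V X. 2 * e 1 V * e 3 X + 2 * e 4 V * e 2 X - (2 * e 1 X * e 3 V + 2 * e 4 X * e 2 V))
    = (\<lambda>V X. 2 * \<sigma>2 V X)"
  "(\<lambda>V X. 2 * e 1 V * e 4 X + 2 * e 2 V * e 3 X - (2 * e 1 X * e 4 V + 2 * e 2 X * e 3 V))
    = (\<lambda>V X. 2 * \<sigma>3 V X)"
  by (simp_all add: fun_eq_iff \<sigma>1_def \<sigma>2_def \<sigma>3_def wedge11_def algebra_simps)

lemma power9_powr: "x > 0 \<Longrightarrow> (x ^ 9) powr (1/9) = (x::real)"
  using powr_powr[of x 9 "1/9"] by simp

lemma powr_power9: "x > 0 \<Longrightarrow> (x powr (1/9)) ^ 9 = (x::real)"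
  by (simp add: powr_power)

section \<open>The metric in terms of \<open>r\<close> and the shifted coordinates\<close>

locale heis =
  fixes C a1 a2 a3 :: real
  assumes C_pos: "C > 0"
begin

abbreviation M where "M \<equiv> heis_domain a1 a2 a3"
abbreviation g where "g \<equiv> heis_metric C a1 a2 a3"

definition w1 :: "heis_space \<Rightarrow> real" where "w1 p = snd p + a1"
definition w2 :: "heis_space \<Rightarrow> real" where "w2 p = snd p + a2"
definition w3 :: "heis_space \<Rightarrow> real" where "w3 p = snd p + a3"
definition r :: "heis_space \<Rightarrow> real" where "r p = (w1 p * w2 p * w3 p) powr (1/9)"

lemma mem_M: "p \<in> M \<longleftrightarrow> w1 p > 0 \<and> w2 p > 0 \<and> w3 p > 0"
  by (cases p) (simp add: heis_domain_def w1_def w2_def w3_def)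

lemma open_M: "open M"
proof -
  have "open {u. u + a1 > 0 \<and> u + a2 > 0 \<and> u + a3 > 0}"
    by (intro open_Collect_conj open_Collect_less continuous_intros)
  then show ?thesis
    unfolding heis_domain_def by (intro open_Times open_UNIV)
qed

lemma w_pos: "p \<in> M \<Longrightarrow> w1 p > 0" "p \<in> M \<Longrightarrow> w2 p > 0" "p \<in> M \<Longrightarrow> w3 p > 0"
  and r_pos: "p \<in> M \<Longrightarrow> r p > 0"
  and r_pow9: "p \<in> M \<Longrightarrow> r p ^ 9 = w1 p * w2 p * w3 p"
proof -
  show w: "p \<in> M \<Longrightarrow> w1 p > 0" "p \<in> M \<Longrightarrow> w2 p > 0" "p \<in> M \<Longrightarrow> w3 p > 0"
    by (simp_all add: mem_M)
  assume "p \<in> M"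
  then have m: "w1 p * w2 p * w3 p > 0" using w by simp
  then show "r p > 0" unfolding r_def by (metis powr_gt_zero less_irrefl)
  show "r p ^ 9 = w1 p * w2 p * w3 p"
    unfolding r_def using m by (rule powr_power9)
qed

text \<open>Since y^8 z^8 / x^10 = (x y z)^8 / x^18, its ninth root is r^8 / x^2; the power 2/3 of x
  y z is r^6.\<close>

lemma metric_eq:
  assumes "p \<in> M"
  shows "g p X Y =
    C * r p * (e 1 X * e 1 Y + e 2 X * e 2 Y + e 3 X * e 3 Y + e 4 X * e 4 Y)
    + 6 / C * (r p ^ 8 / w1 p ^ 2) * (\<eta>1 p X * \<eta>1 p Y)
    + 6 / C * (r p ^ 8 / w2 p ^ 2) * (\<eta>2 p X * \<eta>2 p Y)
    + 6 / C * (r p ^ 8 / w3 p ^ 2) * (\<eta>3 p X * \<eta>3 p Y)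
    + (C / 6) ^ 3 / r p ^ 6 * (snd X * snd Y)"
proof -
  note w = w_pos[OF assms] and rp = r_pos[OF assms]
  have 9: "r p ^ 72 = w1 p ^ 8 * w2 p ^ 8 * w3 p ^ 8"
    using r_pow9[OF assms] power_mult[of "r p" 9 8] by (simp add: power_mult_distrib)
  have h: "(y ^ 8 * z ^ 8 / x ^ 10) powr (1/9) = r p ^ 8 / x ^ 2"
    if "x > 0" "r p ^ 72 = x ^ 8 * y ^ 8 * z ^ 8" for x y z
  proof -
    have "y ^ 8 * z ^ 8 / x ^ 10 = (r p ^ 8 / x ^ 2) ^ 9"
      using that by (simp add: power_divide field_simps flip: power_mult power_add)
    then show ?thesis using that rp by (simp add: power9_powr)
  qed
  have v: "(w1 p * w2 p * w3 p) powr (2/3) = r p ^ 6"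
    using rp powr_powr[of "r p" 9 "2/3"] unfolding r_pow9[OF assms, symmetric] by simp
  have h1: "(w2 p ^ 8 * w3 p ^ 8 / w1 p ^ 10) powr (1/9) = r p ^ 8 / w1 p ^ 2"
    and h2: "(w3 p ^ 8 * w1 p ^ 8 / w2 p ^ 10) powr (1/9) = r p ^ 8 / w2 p ^ 2"
    and h3: "(w1 p ^ 8 * w2 p ^ 8 / w3 p ^ 10) powr (1/9) = r p ^ 8 / w3 p ^ 2"
    by (rule h; use w 9 in simp)+
  show ?thesis
    unfolding heis_metric_def case_prod_beta
    by (simp add: h1[unfolded w1_def w2_def w3_def] h2[unfolded w1_def w2_def w3_def]
        h3[unfolded w1_def w2_def w3_def] v[unfolded w1_def w2_def w3_def])
      (simp add: w1_def w2_def w3_def r_def e_def \<eta>1_def \<eta>2_def \<eta>3_def)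
qed

lemma smooth_w: "smooth_on M w1" "smooth_on M w2" "smooth_on M w3"
  unfolding w1_def w2_def w3_def
  by (intro smooth_on_add smooth_on_const smooth_on_bounded_linear bounded_linear_snd open_M)+

lemma smooth_r: "smooth_on M r"
proof -
  have "smooth_on M (\<lambda>p. (w1 p * w2 p * w3 p) powr (1/9))"
    by (intro smooth_on_powr smooth_on_mult smooth_w open_M mult_pos_pos w_pos)
  then show ?thesis by (simp add: r_def[abs_def])
qed

lemma bilinear_metric:
  assumes "p \<in> M"
  shows "bilinear (g p)"
  unfolding bilinear_def metric_eq[OF assms]
  by (intro conjI allI linearI) (simp_all add: coframe_linear algebra_simps add_divide_distrib)

lemma metric_pos:
  assumes "p \<in> M" "X \<noteq> 0"
  shows "g p X X > 0"
proof (rule ccontr)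
  assume neg: "\<not> g p X X > 0"
  let ?E = "e 1 X * e 1 X + e 2 X * e 2 X + e 3 X * e 3 X + e 4 X * e 4 X"
  have c: "C * r p > 0" "6 / C * (r p ^ 8 / w1 p ^ 2) > 0" "6 / C * (r p ^ 8 / w2 p ^ 2) > 0"
    "6 / C * (r p ^ 8 / w3 p ^ 2) > 0" "(C / 6) ^ 3 / r p ^ 6 > 0"
    using C_pos w_pos[OF assms(1)] r_pos[OF assms(1)] by simp_all
  \<comment> \<open>A sum of nonnegative terms that is not positive has only zero terms; the four
    horizontal squares are bundled into x0.\<close>
  have z: "x0 = 0 \<and> x1 = 0 \<and> x2 = 0 \<and> x3 = 0 \<and> x4 = 0"
    if "\<not> c0 * x0 + c1 * (x1 * x1) + c2 * (x2 * x2) + c3 * (x3 * x3) + c4 * (x4 * x4) > 0"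
      "x0 \<ge> 0" "c0 > 0" "c1 > 0" "c2 > 0" "c3 > 0" "c4 > 0"
    for c0 c1 c2 c3 c4 x0 x1 x2 x3 x4 :: real
  proof -
    have "c0 * x0 \<ge> 0" "c1 * (x1 * x1) \<ge> 0" "c2 * (x2 * x2) \<ge> 0" "c3 * (x3 * x3) \<ge> 0"
      "c4 * (x4 * x4) \<ge> 0"
      using that by simp_all
    then have "c0 * x0 = 0" "c1 * (x1 * x1) = 0" "c2 * (x2 * x2) = 0" "c3 * (x3 * x3) = 0"
      "c4 * (x4 * x4) = 0"
      using that(1) by linarith+
    then show ?thesis using that by simp
  qed
  have "?E = 0 \<and> \<eta>1 p X = 0 \<and> \<eta>2 p X = 0 \<and> \<eta>3 p X = 0 \<and> snd X = 0"
    by (rule z[OF neg[unfolded metric_eq[OF assms(1)]] _ c]) simp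
  then have "e 1 X = 0" "e 2 X = 0" "e 3 X = 0" "e 4 X = 0" "\<eta>1 p X = 0" "\<eta>2 p X = 0" "\<eta>3 p X = 0"
    "snd X = 0"
    by (simp_all add: add_nonneg_eq_0_iff)
  then have "X = 0"
    by (intro coframe_eqI[of X 0 p]) (simp_all add: coframe_defs)
  then show False using assms(2) by simp
qed

lemma riemannian_metric: "riemannian_metric_on M g"
  unfolding riemannian_metric_on_def
proof (intro conjI allI ballI impI)
  fix X Y
  have "smooth_on M (\<lambda>p. C * r p * (e 1 X * e 1 Y + e 2 X * e 2 Y + e 3 X * e 3 Y + e 4 X * e 4 Y)
    + 6 / C * (r p ^ 8 / w1 p ^ 2) * (\<eta>1 p X * \<eta>1 p Y)
    + 6 / C * (r p ^ 8 / w2 p ^ 2) * (\<eta>2 p X * \<eta>2 p Y)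
    + 6 / C * (r p ^ 8 / w3 p ^ 2) * (\<eta>3 p X * \<eta>3 p Y)
    + (C / 6) ^ 3 / r p ^ 6 * (snd X * snd Y))"
    by (rule open_M smooth_on_const smooth_r smooth_w smooth_on_\<eta> smooth_on_add smooth_on_mult
        smooth_on_divide smooth_on_power zero_less_power w_pos r_pos | assumption)+
  then show "smooth_on M (\<lambda>p. g p X Y)"
    using smooth_on_cong[OF open_M] metric_eq by (metis (no_types, lifting))
next
  fix p X Y assume "p \<in> M"
  then show "g p X Y = g p Y X" by (simp add: metric_eq mult.commute)
qed (simp_all add: bilinear_metric metric_pos)

section \<open>The quaternionic triple and its 2-forms\<close>

text \<open>Let E_s and T be the normalised vectors dual to \<eta>_s and du. Then J_s sends T to E_s
  and E_j to E_k for (s, j, k) cyclic; the coefficients are ratios of lengths. On horizontal vectors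
  J_s is the almost complex structure belonging to \<sigma>_s.\<close>

definition J1 :: "heis_space \<Rightarrow> heis_space \<Rightarrow> heis_space" where
  "J1 p X = coframe_vec p (- e 2 X) (e 1 X) (- e 4 X) (e 3 X)
     ((C / 6) ^ 2 * (w1 p / r p ^ 7) * snd X) (- (w2 p / w3 p * \<eta>3 p X)) (w3 p / w2 p * \<eta>2 p X)
     (- (36 / C ^ 2 * (r p ^ 7 / w1 p) * \<eta>1 p X))"

definition J2 :: "heis_space \<Rightarrow> heis_space \<Rightarrow> heis_space" where
  "J2 p X = coframe_vec p (- e 3 X) (e 4 X) (e 1 X) (- e 2 X)
     (w1 p / w3 p * \<eta>3 p X) ((C / 6) ^ 2 * (w2 p / r p ^ 7) * snd X) (- (w3 p / w1 p * \<eta>1 p X))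
     (- (36 / C ^ 2 * (r p ^ 7 / w2 p) * \<eta>2 p X))"

definition J3 :: "heis_space \<Rightarrow> heis_space \<Rightarrow> heis_space" where
  "J3 p X = coframe_vec p (- e 4 X) (- e 3 X) (e 2 X) (e 1 X)
     (- (w1 p / w2 p * \<eta>2 p X)) (w2 p / w1 p * \<eta>1 p X) ((C / 6) ^ 2 * (w3 p / r p ^ 7) * snd X)
     (- (36 / C ^ 2 * (r p ^ 7 / w3 p) * \<eta>3 p X))"

lemma smooth_J: "smooth_on M (\<lambda>p. J1 p X)" "smooth_on M (\<lambda>p. J2 p X)" "smooth_on M (\<lambda>p. J3 p X)"
  unfolding J1_def J2_def J3_def
  by (rule open_M smooth_on_const smooth_on_coframe_vec smooth_r smooth_w smooth_on_\<eta> smooth_on_minus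
      smooth_on_mult smooth_on_divide smooth_on_power zero_less_power w_pos r_pos | assumption)+

lemma quaternionic_triple_J:
  assumes "p \<in> M"
  shows "quaternionic_triple (g p) (J1 p) (J2 p) (J3 p)"
proof -
  have nz: "C \<noteq> 0" "r p \<noteq> 0" "w1 p \<noteq> 0" "w2 p \<noteq> 0" "w3 p \<noteq> 0"
    using C_pos w_pos[OF assms] r_pos[OF assms] by auto
  have "linear (J1 p)" "linear (J2 p)" "linear (J3 p)"
    by (intro linearI; rule coframe_eqI[where p = p];
        simp add: J1_def J2_def J3_def coframe_vec_simps coframe_linear distrib_left distrib_right)+
  moreover have "J1 p (J1 p X) = - X" "J2 p (J2 p X) = - X" "J3 p (J3 p X) = - X"
    "J1 p (J2 p X) = J3 p X" "J2 p (J1 p X) = - J3 p X" for X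
    by (rule coframe_eqI[where p = p];
        simp add: J1_def J2_def J3_def coframe_vec_simps coframe_linear nz divide_simps)+
  moreover have "g p (J1 p X) (J1 p Y) = g p X Y" "g p (J2 p X) (J2 p Y) = g p X Y"
    "g p (J3 p X) (J3 p Y) = g p X Y" for X Y
  proof -
    \<comment> \<open>The length ratios: each map exchanges the du-term with one vertical term and
      the other two vertical terms with each other.\<close>
    have coef: "6 / C * (r p ^ 8 / x ^ 2) * ((C / 6) ^ 2 * (x / r p ^ 7) * s * ((C / 6) ^ 2 * (x / r p ^ 7) * t))
        = (C / 6) ^ 3 / r p ^ 6 * (s * t)"
      "6 / C * (r p ^ 8 / x ^ 2) * (x / y * s * (x / y * t)) = 6 / C * (r p ^ 8 / y ^ 2) * (s * t)"
      "(C / 6) ^ 3 / r p ^ 6 * (36 / C ^ 2 * (r p ^ 7 / x) * s * (36 / C ^ 2 * (r p ^ 7 / x) * t))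
        = 6 / C * (r p ^ 8 / x ^ 2) * (s * t)"
      if "x \<noteq> 0" "y \<noteq> 0" for x y s t
      using that nz by (simp_all add: field_simps eval_nat_numeral)
    show "g p (J1 p X) (J1 p Y) = g p X Y" "g p (J2 p X) (J2 p Y) = g p X Y"
      "g p (J3 p X) (J3 p Y) = g p X Y"
      unfolding metric_eq[OF assms] J1_def J2_def J3_def coframe_vec_simps minus_mult_minus
        coef(1)[OF nz(3) nz(3)] coef(1)[OF nz(4) nz(4)] coef(1)[OF nz(5) nz(5)]
        coef(2)[OF nz(3) nz(4)] coef(2)[OF nz(4) nz(5)] coef(2)[OF nz(5) nz(3)]
        coef(2)[OF nz(4) nz(3)] coef(2)[OF nz(5) nz(4)] coef(2)[OF nz(3) nz(5)]
        coef(3)[OF nz(3) nz(3)] coef(3)[OF nz(4) nz(4)] coef(3)[OF nz(5) nz(5)]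
      by (simp_all only: ac_simps)
  qed
  ultimately show ?thesis
    unfolding quaternionic_triple_def by simp
qed

definition F1 :: "heis_space \<Rightarrow> heis_space \<Rightarrow> heis_space \<Rightarrow> real" where
  "F1 p X Y = C * r p * \<sigma>1 X Y + 6 / C * (w1 p / r p) * wedge11 (\<eta>2 p) (\<eta>3 p) X Y
     - C / 6 * (r p / w1 p) * wedge11 (\<eta>1 p) snd X Y"

definition F2 :: "heis_space \<Rightarrow> heis_space \<Rightarrow> heis_space \<Rightarrow> real" where
  "F2 p X Y = C * r p * \<sigma>2 X Y + 6 / C * (w2 p / r p) * wedge11 (\<eta>3 p) (\<eta>1 p) X Y
     - C / 6 * (r p / w2 p) * wedge11 (\<eta>2 p) snd X Y"

definition F3 :: "heis_space \<Rightarrow> heis_space \<Rightarrow> heis_space \<Rightarrow> real" where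
  "F3 p X Y = C * r p * \<sigma>3 X Y + 6 / C * (w3 p / r p) * wedge11 (\<eta>1 p) (\<eta>2 p) X Y
     - C / 6 * (r p / w3 p) * wedge11 (\<eta>3 p) snd X Y"

lemma two_form_J:
  assumes "p \<in> M"
  shows "two_form (g p) (J1 p) = F1 p" "two_form (g p) (J2 p) = F2 p" "two_form (g p) (J3 p) = F3 p"
proof -
  note w = w_pos[OF assms] and rp = r_pos[OF assms] and r9 = r_pow9[OF assms]
  \<comment> \<open>The relation r^9 = x y z turns r^8 / (x y) into z / r. It is stated for general
    x, y, z because every ordered pair of vertical directions occurs.\<close>
  have h: "6 / C * (r p ^ 8 / x ^ 2) * (x / y * s * t) = 6 / C * (z / r p) * (s * t)"
    if "r p ^ 9 = x * y * z" "x > 0" "y > 0" "z > 0" for x y z s t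
  proof -
    have "r p ^ 8 * r p = x * y * z"
      using that(1) by (simp add: power_Suc2[symmetric])
    then have "r p ^ 8 = x * y * z / r p" using rp by (simp add: field_simps)
    then show ?thesis using that C_pos rp by (simp add: field_simps power2_eq_square)
  qed
  have v: "6 / C * (r p ^ 8 / x ^ 2) * ((C / 6) ^ 2 * (x / r p ^ 7) * s * t) = C / 6 * (r p / x) * (s * t)"
    and v': "(C / 6) ^ 3 / r p ^ 6 * (36 / C ^ 2 * (r p ^ 7 / x) * s * t) = C / 6 * (r p / x) * (s * t)"
    if "x > 0" for x s t
    using that rp C_pos by (simp_all add: field_simps eval_nat_numeral)
  have r9': "r p ^ 9 = w2 p * w3 p * w1 p" "r p ^ 9 = w3 p * w1 p * w2 p" "r p ^ 9 = w1 p * w2 p * w3 p"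
    "r p ^ 9 = w3 p * w2 p * w1 p" "r p ^ 9 = w1 p * w3 p * w2 p" "r p ^ 9 = w2 p * w1 p * w3 p"
    by (simp_all add: r9)
  show "two_form (g p) (J1 p) = F1 p" "two_form (g p) (J2 p) = F2 p" "two_form (g p) (J3 p) = F3 p"
    unfolding fun_eq_iff two_form_def metric_eq[OF assms] J1_def J2_def J3_def coframe_vec_simps
      F1_def F2_def F3_def mult_minus_left mult_minus_right v[OF w(1)] v[OF w(2)] v[OF w(3)]
      v'[OF w(1)] v'[OF w(2)] v'[OF w(3)]
      h[OF r9'(1) w(2) w(3) w(1)] h[OF r9'(2) w(3) w(1) w(2)] h[OF r9'(3) w(1) w(2) w(3)]
      h[OF r9'(4) w(3) w(2) w(1)] h[OF r9'(5) w(1) w(3) w(2)] h[OF r9'(6) w(2) w(1) w(3)]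
      \<sigma>1_def \<sigma>2_def \<sigma>3_def wedge11_def
    by (simp_all add: algebra_simps add_divide_distrib diff_divide_distrib)
qed


subsection \<open>Closedness of the fundamental form\<close>

lemma has_derivative_w:
  "(w1 has_derivative snd) (at p)" "(w2 has_derivative snd) (at p)" "(w3 has_derivative snd) (at p)"
  unfolding w1_def[abs_def] w2_def[abs_def] w3_def[abs_def] by (auto intro!: derivative_eq_intros)

definition r' :: "heis_space \<Rightarrow> real" where
  "r' p = r p / 9 * (1 / w1 p + 1 / w2 p + 1 / w3 p)"

lemma has_derivative_r:
  assumes "p \<in> M"
  shows "(r has_derivative (\<lambda>V. r' p * snd V)) (at p)"
proof -
  note w = w_pos[OF assms]
  have "((\<lambda>p. w1 p * w2 p * w3 p) has_derivative
      (\<lambda>V. (w2 p * w3 p + w1 p * w3 p + w1 p * w2 p) * snd V)) (at p)"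
    by (rule derivative_eq_intros has_derivative_w refl)+ (simp add: algebra_simps)
  then have "((\<lambda>p. (w1 p * w2 p * w3 p) powr (1/9)) has_derivative
      (\<lambda>V. (w1 p * w2 p * w3 p) powr (1/9) * (0 * ln (w1 p * w2 p * w3 p)
        + (w2 p * w3 p + w1 p * w3 p + w1 p * w2 p) * snd V * (1/9) / (w1 p * w2 p * w3 p)))) (at p)"
    by (rule has_derivative_powr[OF _ has_derivative_const]) (use w in simp_all)
  moreover have "(w1 p * w2 p * w3 p) powr (1/9) * (0 * ln (w1 p * w2 p * w3 p)
        + (w2 p * w3 p + w1 p * w3 p + w1 p * w2 p) * s * (1/9) / (w1 p * w2 p * w3 p)) = r' p * s" for s
    using w by (simp add: r'_def r_def field_simps)
  ultimately show ?thesis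
    by (simp add: r_def[abs_def])
qed

text \<open>The function w stands for any of the three shifted coordinates. The first three rules
  serve the 2-forms; the first and the last two serve the metric.\<close>

lemma has_derivative_coeffs:
  assumes p: "p \<in> M" and w: "w p > 0" "(w has_derivative snd) (at p)"
  shows "((\<lambda>q. C * r q) has_derivative (\<lambda>V. C * r' p * snd V)) (at p)"
    and "((\<lambda>q. 6 / C * (w q / r q)) has_derivative (\<lambda>V. 6 / C * (1 / r p - w p * r' p / r p ^ 2) * snd V)) (at p)"
    and "((\<lambda>q. C / 6 * (r q / w q)) has_derivative (\<lambda>V. C / 6 * (r' p / w p - r p / w p ^ 2) * snd V)) (at p)"
    and "((\<lambda>q. 6 / C * (r q ^ 8 / w q ^ 2)) has_derivative
      (\<lambda>V. 6 / C * (r p ^ 8 / w p ^ 2) * (8 * r' p / r p - 2 / w p) * snd V)) (at p)"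
    and "((\<lambda>q. (C / 6) ^ 3 / r q ^ 6) has_derivative
      (\<lambda>V. (C / 6) ^ 3 / r p ^ 6 * (- 6 * r' p / r p) * snd V)) (at p)"
proof -
  have nz: "r p \<noteq> 0" "w p \<noteq> 0" using r_pos[OF p] w by auto
  note d = has_derivative_r[OF p] w(2)
  show "((\<lambda>q. C * r q) has_derivative (\<lambda>V. C * r' p * snd V)) (at p)"
    by (rule derivative_eq_intros d refl)+ (simp add: fun_eq_iff)
  show "((\<lambda>q. 6 / C * (w q / r q)) has_derivative (\<lambda>V. 6 / C * (1 / r p - w p * r' p / r p ^ 2) * snd V)) (at p)"
    by (rule derivative_eq_intros d refl nz)+ (use nz in \<open>simp add: fun_eq_iff field_simps power2_eq_square\<close>)
  show "((\<lambda>q. C / 6 * (r q / w q)) has_derivative (\<lambda>V. C / 6 * (r' p / w p - r p / w p ^ 2) * snd V)) (at p)"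
    by (rule derivative_eq_intros d refl nz)+ (use nz in \<open>simp add: fun_eq_iff field_simps power2_eq_square\<close>)
  show "((\<lambda>q. 6 / C * (r q ^ 8 / w q ^ 2)) has_derivative
      (\<lambda>V. 6 / C * (r p ^ 8 / w p ^ 2) * (8 * r' p / r p - 2 / w p) * snd V)) (at p)"
    by (rule derivative_eq_intros d refl power_not_zero nz)+
      (use nz C_pos in \<open>simp add: fun_eq_iff divide_simps eval_nat_numeral, (simp add: algebra_simps)?\<close>)
  show "((\<lambda>q. (C / 6) ^ 3 / r q ^ 6) has_derivative
      (\<lambda>V. (C / 6) ^ 3 / r p ^ 6 * (- 6 * r' p / r p) * snd V)) (at p)"
    by (rule derivative_eq_intros d refl power_not_zero nz)+
      (use nz C_pos in \<open>simp add: fun_eq_iff divide_simps eval_nat_numeral, (simp add: algebra_simps)?\<close>)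
qed

text \<open>The beta-redexes name the coefficient functions for unification in \<open>ext_deriv2_coframe\<close>.\<close>

lemma F_forms:
  "F1 q X Y = (\<lambda>q. C * r q) q * \<sigma>1 X Y + (\<lambda>q. 6 / C * (w1 q / r q)) q * wedge11 (\<eta>2 q) (\<eta>3 q) X Y
    - (\<lambda>q. C / 6 * (r q / w1 q)) q * wedge11 (\<eta>1 q) snd X Y"
  "F2 q X Y = (\<lambda>q. C * r q) q * \<sigma>2 X Y + (\<lambda>q. 6 / C * (w2 q / r q)) q * wedge11 (\<eta>3 q) (\<eta>1 q) X Y
    - (\<lambda>q. C / 6 * (r q / w2 q)) q * wedge11 (\<eta>2 q) snd X Y"
  "F3 q X Y = (\<lambda>q. C * r q) q * \<sigma>3 X Y + (\<lambda>q. 6 / C * (w3 q / r q)) q * wedge11 (\<eta>1 q) (\<eta>2 q) X Y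
    - (\<lambda>q. C / 6 * (r q / w3 q)) q * wedge11 (\<eta>3 q) snd X Y"
  by (simp_all add: F1_def F2_def F3_def)

text \<open>Each of the three coefficient rules needs \<open>p \<in> M\<close> once directly and
  once through \<open>w_pos\<close>; hence the six copies of that premise supplied at each
  use.\<close>

lemmas F1_derivs = ext_deriv2_coframe[where F = F1 and \<alpha> = \<eta>2 and \<beta> = \<eta>3 and \<gamma> = \<eta>1 and \<tau> = snd,
    OF F_forms(1) has_derivative_coeffs(1,2,3) has_derivative_\<eta>(2,3,1),
    OF _ w_pos(1) has_derivative_w(1) _ w_pos(1) has_derivative_w(1) _ w_pos(1) has_derivative_w(1)]

lemmas F2_derivs = ext_deriv2_coframe[where F = F2 and \<alpha> = \<eta>3 and \<beta> = \<eta>1 and \<gamma> = \<eta>2 and \<tau> = snd,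
    OF F_forms(2) has_derivative_coeffs(1,2,3) has_derivative_\<eta>(3,1,2),
    OF _ w_pos(2) has_derivative_w(2) _ w_pos(2) has_derivative_w(2) _ w_pos(2) has_derivative_w(2)]

lemmas F3_derivs = ext_deriv2_coframe[where F = F3 and \<alpha> = \<eta>1 and \<beta> = \<eta>2 and \<gamma> = \<eta>3 and \<tau> = snd,
    OF F_forms(3) has_derivative_coeffs(1,2,3) has_derivative_\<eta>(1,2,3),
    OF _ w_pos(3) has_derivative_w(3) _ w_pos(3) has_derivative_w(3) _ w_pos(3) has_derivative_w(3)]

lemma wedge12_double: "wedge12 \<alpha> (\<lambda>X Y. 2 * \<sigma> X Y) X Y Z = 2 * wedge12 \<alpha> \<sigma> X Y Z"
  by (simp add: wedge12_def)

lemma ext_deriv2_F: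
  assumes p: "p \<in> M"
  shows "ext_deriv2 F1 p = (\<lambda>X Y Z. C * r' p * wedge12 snd \<sigma>1 X Y Z
      + 6 / C * (1 / r p - w1 p * r' p / r p ^ 2) * wedge12 snd (wedge11 (\<eta>2 p) (\<eta>3 p)) X Y Z
      + 6 / C * (w1 p / r p) * (2 * wedge12 (\<eta>3 p) \<sigma>2 X Y Z - 2 * wedge12 (\<eta>2 p) \<sigma>3 X Y Z)
      - C / 6 * (r p / w1 p) * (2 * wedge12 snd \<sigma>1 X Y Z))"
    and "ext_deriv2 F2 p = (\<lambda>X Y Z. C * r' p * wedge12 snd \<sigma>2 X Y Z
      + 6 / C * (1 / r p - w2 p * r' p / r p ^ 2) * wedge12 snd (wedge11 (\<eta>3 p) (\<eta>1 p)) X Y Z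
      + 6 / C * (w2 p / r p) * (2 * wedge12 (\<eta>1 p) \<sigma>3 X Y Z - 2 * wedge12 (\<eta>3 p) \<sigma>1 X Y Z)
      - C / 6 * (r p / w2 p) * (2 * wedge12 snd \<sigma>2 X Y Z))"
    and "ext_deriv2 F3 p = (\<lambda>X Y Z. C * r' p * wedge12 snd \<sigma>3 X Y Z
      + 6 / C * (1 / r p - w3 p * r' p / r p ^ 2) * wedge12 snd (wedge11 (\<eta>1 p) (\<eta>2 p)) X Y Z
      + 6 / C * (w3 p / r p) * (2 * wedge12 (\<eta>2 p) \<sigma>1 X Y Z - 2 * wedge12 (\<eta>1 p) \<sigma>2 X Y Z)
      - C / 6 * (r p / w3 p) * (2 * wedge12 snd \<sigma>3 X Y Z))"
  unfolding fun_eq_iff F1_derivs(2)[OF p p p p p p] F2_derivs(2)[OF p p p p p p]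
    F3_derivs(2)[OF p p p p p p] d\<eta> wedge12_double
  by simp_all

lemma F_eq:
  "F1 p = (\<lambda>X Y. C * r p * \<sigma>1 X Y + 6 / C * (w1 p / r p) * wedge11 (\<eta>2 p) (\<eta>3 p) X Y
     - C / 6 * (r p / w1 p) * wedge11 (\<eta>1 p) snd X Y)"
  "F2 p = (\<lambda>X Y. C * r p * \<sigma>2 X Y + 6 / C * (w2 p / r p) * wedge11 (\<eta>3 p) (\<eta>1 p) X Y
     - C / 6 * (r p / w2 p) * wedge11 (\<eta>2 p) snd X Y)"
  "F3 p = (\<lambda>X Y. C * r p * \<sigma>3 X Y + 6 / C * (w3 p / r p) * wedge11 (\<eta>1 p) (\<eta>2 p) X Y
     - C / 6 * (r p / w3 p) * wedge11 (\<eta>3 p) snd X Y)"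
  by (simp_all add: fun_eq_iff F1_def F2_def F3_def)

lemma wedge14_zero: "wedge14 \<alpha> (\<lambda>X Y Z W. 0) V X Y Z W = 0"
  by (simp add: wedge14_def)

text \<open>The other products vanish: they contain a wedge of two different \<sigma>s, the square
  of a decomposable form, or a repeated 1-form. The survivors are rotated so that \<tau> comes
  first.\<close>

lemma wedge32_coframe:
  fixes A A' b b' d :: real
  assumes s: "wedge22 \<sigma>' \<sigma> = (\<lambda>X Y Z W. 0)" "wedge22 \<sigma>'' \<sigma> = (\<lambda>X Y Z W. 0)"
  shows "wedge32 (\<lambda>X Y Z. A' * wedge12 \<tau> \<sigma> X Y Z + b' * wedge12 \<tau> (wedge11 \<alpha> \<beta>) X Y Z
      + b * (2 * wedge12 \<beta> \<sigma>' X Y Z - 2 * wedge12 \<alpha> \<sigma>'' X Y Z) - d * (2 * wedge12 \<tau> \<sigma> X Y Z))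
      (\<lambda>X Y. A * \<sigma> X Y + b * wedge11 \<alpha> \<beta> X Y - d * wedge11 \<gamma> \<tau> X Y) V X Y Z W
    = (A' - 2 * d) * A * wedge14 \<tau> (wedge22 \<sigma> \<sigma>) V X Y Z W
      + (A' * b + A * b' - 2 * b * d) * wedge14 \<tau> (wedge22 \<sigma> (wedge11 \<alpha> \<beta>)) V X Y Z W
      - 2 * (b * d) * wedge14 \<tau> (wedge22 \<sigma>' (wedge11 \<beta> \<gamma>)) V X Y Z W
      - 2 * (b * d) * wedge14 \<tau> (wedge22 \<sigma>'' (wedge11 \<gamma> \<alpha>)) V X Y Z W"
proof -
  have dec: "wedge22 (wedge11 \<alpha> \<beta>) (wedge11 \<alpha> \<beta>) = (\<lambda>X Y Z W. 0)"
    by (intro ext) (rule wedge22_decomposable)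
  have rot: "wedge14 \<beta> (wedge22 \<sigma>' (wedge11 \<gamma> \<tau>)) V X Y Z W = wedge14 \<tau> (wedge22 \<sigma>' (wedge11 \<beta> \<gamma>)) V X Y Z W"
    "wedge14 \<alpha> (wedge22 \<sigma>'' (wedge11 \<gamma> \<tau>)) V X Y Z W = - wedge14 \<tau> (wedge22 \<sigma>'' (wedge11 \<gamma> \<alpha>)) V X Y Z W"
    using wedge14_wedge22_rotate wedge14_wedge22_swap by metis+
  show ?thesis
    unfolding wedge32_linear wedge32_wedge12 wedge22_commute[of "wedge11 \<alpha> \<beta>" \<sigma>] s dec rot
      wedge14_wedge22_repeated wedge14_zero
    by (simp add: algebra_simps)
qed

lemma d_fundamental_form:
  assumes p: "p \<in> M"
  shows "wedge32 (ext_deriv2 F1 p) (F1 p) V X Y Z W + wedge32 (ext_deriv2 F2 p) (F2 p) V X Y Z W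
    + wedge32 (ext_deriv2 F3 p) (F3 p) V X Y Z W = 0"
proof -
  note w = w_pos[OF p] and rp = r_pos[OF p]
  \<comment> \<open>With A = C r, b = 6 w / (C r) and d = C r / (6 w), the product b d is 1, and A b
    = 6 w has derivative 6.\<close>
  have bd: "6 / C * (w / r p) * (C / 6 * (r p / w)) = 1"
    and bA: "C * r' p * (6 / C * (w / r p)) + C * r p * (6 / C * (1 / r p - w * r' p / r p ^ 2)) = 6"
    if "w > 0" for w
    using that rp C_pos by (simp_all add: field_simps power2_eq_square)
  have A: "3 * (C * r' p) = 2 * (C / 6 * (r p / w1 p)) + 2 * (C / 6 * (r p / w2 p)) + 2 * (C / 6 * (r p / w3 p))"
    using w by (simp add: r'_def field_simps)
  \<comment> \<open>Each T_i receives 6 - 2 from its own summand and -2 from each of the other two.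
    The coefficient of S vanishes by the formula for r'.\<close>
  have comb: "(A' - 2 * d1) * A * S + (A' * b1 + A * b1' - 2 * b1 * d1) * T1 - 2 * (b1 * d1) * T2 - 2 * (b1 * d1) * T3
      + ((A' - 2 * d2) * A * S + (A' * b2 + A * b2' - 2 * b2 * d2) * T2 - 2 * (b2 * d2) * T3 - 2 * (b2 * d2) * T1)
      + ((A' - 2 * d3) * A * S + (A' * b3 + A * b3' - 2 * b3 * d3) * T3 - 2 * (b3 * d3) * T1 - 2 * (b3 * d3) * T2) = 0"
    if "b1 * d1 = 1" "b2 * d2 = 1" "b3 * d3 = 1" "A' * b1 + A * b1' = 6" "A' * b2 + A * b2' = 6"
      "A' * b3 + A * b3' = 6" "3 * A' = 2 * d1 + 2 * d2 + 2 * d3"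
    for A' A d1 d2 d3 b1 b2 b3 b1' b2' b3' S T1 T2 T3 :: real
  proof -
    have "(A' - 2 * d1) * A * S + (A' - 2 * d2) * A * S + (A' - 2 * d3) * A * S
        = (3 * A' - (2 * d1 + 2 * d2 + 2 * d3)) * (A * S)"
      by (simp add: algebra_simps)
    then show ?thesis unfolding that mult.assoc[of 2] by simp
  qed
  show ?thesis
    unfolding ext_deriv2_F[OF p] F_eq
      wedge32_coframe[OF wedge22_\<sigma>(4,5)] wedge32_coframe[OF wedge22_\<sigma>(6,1)]
      wedge32_coframe[OF wedge22_\<sigma>(2,3)] wedge22_\<sigma>(7,8)
    by (rule comb; intro bd bA w A)
qed

definition \<Phi> :: "heis_space \<Rightarrow> heis_space \<Rightarrow> heis_space \<Rightarrow> heis_space \<Rightarrow> heis_space \<Rightarrow> real" where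
  "\<Phi> p X Y Z W = wedge22 (F1 p) (F1 p) X Y Z W + wedge22 (F2 p) (F2 p) X Y Z W + wedge22 (F3 p) (F3 p) X Y Z W"

lemma F_differentiable:
  assumes p: "p \<in> M"
  shows "(\<lambda>q. F1 q X Y) differentiable (at p)" "(\<lambda>q. F2 q X Y) differentiable (at p)"
    "(\<lambda>q. F3 q X Y) differentiable (at p)"
  using F1_derivs(1)[OF p p p p p p] F2_derivs(1)[OF p p p p p p] F3_derivs(1)[OF p p p p p p]
  unfolding differentiable_def by blast+

lemma closed_\<Phi>:
  assumes p: "p \<in> M"
  shows "ext_deriv4 \<Phi> p V X Y Z W = 0"
proof -
  note diff = F_differentiable[OF p]
  have "ext_deriv4 \<Phi> p V X Y Z W = ext_deriv4 (\<lambda>q. wedge22 (F1 q) (F1 q)) p V X Y Z W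
    + ext_deriv4 (\<lambda>q. wedge22 (F2 q) (F2 q)) p V X Y Z W + ext_deriv4 (\<lambda>q. wedge22 (F3 q) (F3 q)) p V X Y Z W"
    unfolding \<Phi>_def[abs_def]
    by (simp add: ext_deriv4_add differentiable_wedge22_self diff)
  then show ?thesis
    unfolding ext_deriv4_wedge22_self[OF diff(1)] ext_deriv4_wedge22_self[OF diff(2)]
      ext_deriv4_wedge22_self[OF diff(3)]
    using d_fundamental_form[OF p, of V X Y Z W] by simp
qed


subsection \<open>Failure of parallelism\<close>

definition Q :: "heis_space \<Rightarrow> (heis_space \<Rightarrow> heis_space) set" where
  "Q p = endo_span (J1 p) (J2 p) (J3 p)"

text \<open>The triple is defined globally, so M itself serves as the neighbourhood of each
  point.\<close>

lemma almost_quaternion_hermitian_Q: "almost_quaternion_hermitian M g Q"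
  unfolding almost_quaternion_hermitian_def
proof (intro conjI ballI riemannian_metric)
  fix p assume "p \<in> M"
  moreover have "\<forall>J\<in>{J1, J2, J3}. \<forall>v. smooth_on M (\<lambda>q. J q v)"
    using smooth_J by blast
  ultimately show "\<exists>U J1 J2 J3. open U \<and> p \<in> U \<and> U \<subseteq> M \<and>
        (\<forall>J\<in>{J1, J2, J3}. \<forall>v. smooth_on U (\<lambda>q. J q v)) \<and>
        (\<forall>q\<in>U. quaternionic_triple (g q) (J1 q) (J2 q) (J3 q) \<and>
                Q q = endo_span (J1 q) (J2 q) (J3 q))"
    using open_M quaternionic_triple_J unfolding Q_def
    by (intro exI[of _ M] exI[of _ J1] exI[of _ J2] exI[of _ J3]) simp
qed

lemma fundamental_form_Q:
  assumes "p \<in> M"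
  shows "fundamental_form g Q p = \<Phi> p"
  using fundamental_form_eq[where g = g and Q = Q, OF quaternionic_triple_J[OF assms] Q_def bilinear_metric[OF assms]]
  by (simp add: fun_eq_iff \<Phi>_def two_form_J[OF assms])

lemma dir_deriv_fundamental_form_Q:
  assumes "p \<in> M"
  shows "dir_deriv (\<lambda>q. fundamental_form g Q q X Y Z W) p V = dir_deriv (\<lambda>q. \<Phi> q X Y Z W) p V"
  by (rule dir_deriv_cong[OF open_M assms]) (simp add: fundamental_form_Q)

lemma closed_fundamental_form_Q: "closed_form4_on M (fundamental_form g Q)"
  using closed_\<Phi> unfolding closed_form4_on_def ext_deriv4_def by (simp add: dir_deriv_fundamental_form_Q)

section \<open>Christoffel symbols and components of the form over the origin\<close>

lemma dir_deriv_metric: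
  assumes p: "p \<in> M"
  shows "dir_deriv (\<lambda>q. g q Y Z) p X =
    C * r' p * snd X * (e 1 Y * e 1 Z + e 2 Y * e 2 Z + e 3 Y * e 3 Z + e 4 Y * e 4 Z)
    + 6 / C * (r p ^ 8 / w1 p ^ 2) * (8 * r' p / r p - 2 / w1 p) * snd X * (\<eta>1 p Y * \<eta>1 p Z)
    + 6 / C * (r p ^ 8 / w1 p ^ 2) * (\<eta>1 p Y * (2 * e 1 X * e 2 Z + 2 * e 3 X * e 4 Z)
        + (2 * e 1 X * e 2 Y + 2 * e 3 X * e 4 Y) * \<eta>1 p Z)
    + 6 / C * (r p ^ 8 / w2 p ^ 2) * (8 * r' p / r p - 2 / w2 p) * snd X * (\<eta>2 p Y * \<eta>2 p Z)
    + 6 / C * (r p ^ 8 / w2 p ^ 2) * (\<eta>2 p Y * (2 * e 1 X * e 3 Z + 2 * e 4 X * e 2 Z)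
        + (2 * e 1 X * e 3 Y + 2 * e 4 X * e 2 Y) * \<eta>2 p Z)
    + 6 / C * (r p ^ 8 / w3 p ^ 2) * (8 * r' p / r p - 2 / w3 p) * snd X * (\<eta>3 p Y * \<eta>3 p Z)
    + 6 / C * (r p ^ 8 / w3 p ^ 2) * (\<eta>3 p Y * (2 * e 1 X * e 4 Z + 2 * e 2 X * e 3 Z)
        + (2 * e 1 X * e 4 Y + 2 * e 2 X * e 3 Y) * \<eta>3 p Z)
    + (C / 6) ^ 3 / r p ^ 6 * (- 6 * r' p / r p) * snd X * (snd Y * snd Z)" (is "_ = ?D X")
proof -
  note c = has_derivative_coeffs(1,4,5)[OF p w_pos(1)[OF p] has_derivative_w(1)]
    has_derivative_coeffs(4)[OF p w_pos(2)[OF p] has_derivative_w(2)]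
    has_derivative_coeffs(4)[OF p w_pos(3)[OF p] has_derivative_w(3)]
  let ?G = "\<lambda>p. C * r p * (e 1 Y * e 1 Z + e 2 Y * e 2 Z + e 3 Y * e 3 Z + e 4 Y * e 4 Z)
    + 6 / C * (r p ^ 8 / w1 p ^ 2) * (\<eta>1 p Y * \<eta>1 p Z)
    + 6 / C * (r p ^ 8 / w2 p ^ 2) * (\<eta>2 p Y * \<eta>2 p Z)
    + 6 / C * (r p ^ 8 / w3 p ^ 2) * (\<eta>3 p Y * \<eta>3 p Z)
    + (C / 6) ^ 3 / r p ^ 6 * (snd Y * snd Z)"
  have "(?G has_derivative ?D) (at p)"
    by (rule has_derivative_eq_rhs,
        (rule c has_derivative_\<eta> has_derivative_const has_derivative_add has_derivative_mult)+)
      (simp add: fun_eq_iff)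
  then have "dir_deriv ?G p X = ?D X"
    by (rule dir_deriv_eq)
  moreover have "dir_deriv (\<lambda>q. g q Y Z) p X = dir_deriv ?G p X"
    by (rule dir_deriv_cong[OF open_M p]) (rule metric_eq)
  ultimately show ?thesis by (rule trans[rotated])
qed

definition dx :: "7 \<Rightarrow> heis_space" where "dx i = (axis i 1, 0)"
definition du :: "heis_space" where "du = (0, 1)"

text \<open>Over the origin of the group the coordinate vectors are dual to the coframe, so
  evaluation there needs no correction terms.\<close>

lemma coframe_dx:
  assumes "fst p = 0"
  shows "e i (dx j) = (if i = j then 1 else 0)" "\<eta>1 p (dx j) = (if j = 5 then 1 else 0)"
    "\<eta>2 p (dx j) = (if j = 6 then 1 else 0)" "\<eta>3 p (dx j) = (if j = 7 then 1 else 0)"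
    "snd (dx j) = 0"
    "e i du = 0" "\<eta>1 p du = 0" "\<eta>2 p du = 0" "\<eta>3 p du = 0" "snd du = 1"
  using assms by (auto simp: coframe_defs dx_def du_def axis_def)

text \<open>Exactly the symbols entering the two components of the covariant derivative tested
  below. Horizontal vectors are rotated because d\<eta>_s is nonzero; the du-terms come from the
  u-dependence of the length dual to \<eta>_s.\<close>

lemma levi_civita_dx:
  assumes p: "p \<in> M" "fst p = 0"
  shows "levi_civita g p (dx 5) (dx 1) = (6 / C * (r p ^ 8 / w1 p ^ 2) / (C * r p)) *\<^sub>R dx 2"
    "levi_civita g p (dx 5) (dx 3) = (6 / C * (r p ^ 8 / w1 p ^ 2) / (C * r p)) *\<^sub>R dx 4"
    "levi_civita g p (dx 5) (dx 5) = (- (6 / C * (r p ^ 8 / w1 p ^ 2) * (8 * r' p / r p - 2 / w1 p))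
      / (2 * ((C / 6) ^ 3 / r p ^ 6))) *\<^sub>R du"
    "levi_civita g p (dx 5) (dx 6) = 0"
    "levi_civita g p (dx 6) (dx 1) = (6 / C * (r p ^ 8 / w2 p ^ 2) / (C * r p)) *\<^sub>R dx 3"
    "levi_civita g p (dx 6) (dx 4) = (6 / C * (r p ^ 8 / w2 p ^ 2) / (C * r p)) *\<^sub>R dx 2"
    "levi_civita g p (dx 6) (dx 6) = (- (6 / C * (r p ^ 8 / w2 p ^ 2) * (8 * r' p / r p - 2 / w2 p))
      / (2 * ((C / 6) ^ 3 / r p ^ 6))) *\<^sub>R du"
    "levi_civita g p (dx 6) (dx 7) = 0"
proof -
  have nz: "C \<noteq> 0" "r p \<noteq> 0" "w1 p \<noteq> 0" "w2 p \<noteq> 0"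
    using C_pos r_pos[OF p(1)] w_pos[OF p(1)] by auto
  have zero: "e i 0 = 0" "\<eta>1 p 0 = 0" "\<eta>2 p 0 = 0" "\<eta>3 p 0 = 0" for i p
    by (simp_all add: coframe_defs)
  show "levi_civita g p (dx 5) (dx 1) = (6 / C * (r p ^ 8 / w1 p ^ 2) / (C * r p)) *\<^sub>R dx 2"
    "levi_civita g p (dx 5) (dx 3) = (6 / C * (r p ^ 8 / w1 p ^ 2) / (C * r p)) *\<^sub>R dx 4"
    "levi_civita g p (dx 5) (dx 5) = (- (6 / C * (r p ^ 8 / w1 p ^ 2) * (8 * r' p / r p - 2 / w1 p))
      / (2 * ((C / 6) ^ 3 / r p ^ 6))) *\<^sub>R du"
    "levi_civita g p (dx 5) (dx 6) = 0"
    "levi_civita g p (dx 6) (dx 1) = (6 / C * (r p ^ 8 / w2 p ^ 2) / (C * r p)) *\<^sub>R dx 3"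
    "levi_civita g p (dx 6) (dx 4) = (6 / C * (r p ^ 8 / w2 p ^ 2) / (C * r p)) *\<^sub>R dx 2"
    "levi_civita g p (dx 6) (dx 6) = (- (6 / C * (r p ^ 8 / w2 p ^ 2) * (8 * r' p / r p - 2 / w2 p))
      / (2 * ((C / 6) ^ 3 / r p ^ 6))) *\<^sub>R du"
    "levi_civita g p (dx 6) (dx 7) = 0"
    by (rule levi_civita_eqI[OF riemannian_metric open_M p(1)];
        use nz in \<open>simp add: metric_eq[OF p(1)] dir_deriv_metric[OF p(1)] coframe_linear coframe_dx[OF p(2)] zero field_simps\<close>)+
qed

text \<open>The components that remain once these Christoffel symbols are inserted: three for each
  of the two directions.\<close>

lemma \<Phi>_dx:
  assumes p: "p \<in> M" "fst p = 0"
  shows "\<Phi> p (dx 2) (dx 3) (dx 5) (dx 6) = 12 * w3 p" "\<Phi> p (dx 1) (dx 4) (dx 5) (dx 6) = 12 * w3 p"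
    "\<Phi> p (dx 1) (dx 3) du (dx 6) = C ^ 2 / 3 * (r p ^ 2 / w2 p)"
    "\<Phi> p (dx 3) (dx 4) (dx 6) (dx 7) = 12 * w1 p" "\<Phi> p (dx 1) (dx 2) (dx 6) (dx 7) = 12 * w1 p"
    "\<Phi> p (dx 1) (dx 4) du (dx 7) = C ^ 2 / 3 * (r p ^ 2 / w3 p)"
  using C_pos r_pos[OF p(1)] w_pos[OF p(1)]
  by (simp_all add: \<Phi>_def wedge22_self F1_def F2_def F3_def \<sigma>1_def \<sigma>2_def \<sigma>3_def wedge11_def
      coframe_dx[OF p(2)] field_simps power2_eq_square)

text \<open>In coordinates \<Phi> depends on x1, ..., x4 and u only, so it is constant along the
  directions x5, x6, x7.\<close>

lemma dir_deriv_\<Phi>_vertical: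
  assumes p: "p \<in> M" and V: "e 1 V = 0" "e 2 V = 0" "e 3 V = 0" "e 4 V = 0" "snd V = 0"
  shows "dir_deriv (\<lambda>q. \<Phi> q X Y Z W) p V = 0"
proof -
  note F = F_differentiable[OF p]
  have 0: "dir_deriv (\<lambda>q. F1 q X Y) p V = 0" "dir_deriv (\<lambda>q. F2 q X Y) p V = 0"
    "dir_deriv (\<lambda>q. F3 q X Y) p V = 0" for X Y
    unfolding dir_deriv_eq[OF F1_derivs(1)[OF p p p p p p]] dir_deriv_eq[OF F2_derivs(1)[OF p p p p p p]]
      dir_deriv_eq[OF F3_derivs(1)[OF p p p p p p]] V by simp_all
  have "dir_deriv (\<lambda>q. \<Phi> q X Y Z W) p V = dir_deriv (\<lambda>q. wedge22 (F1 q) (F1 q) X Y Z W) p V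
    + dir_deriv (\<lambda>q. wedge22 (F2 q) (F2 q) X Y Z W) p V + dir_deriv (\<lambda>q. wedge22 (F3 q) (F3 q) X Y Z W) p V"
    unfolding \<Phi>_def
    by (rule dir_deriv_eq)
      (intro has_derivative_add has_derivative_dir_deriv differentiable_wedge22_self F)
  then show ?thesis
    unfolding dir_deriv_wedge22_self[OF F(1)] dir_deriv_wedge22_self[OF F(2)]
      dir_deriv_wedge22_self[OF F(3)] 0 by simp
qed

lemma \<Phi>_linear:
  "\<Phi> p (c *\<^sub>R X) Y Z W = c * \<Phi> p X Y Z W" "\<Phi> p X (c *\<^sub>R Y) Z W = c * \<Phi> p X Y Z W"
  "\<Phi> p X Y (c *\<^sub>R Z) W = c * \<Phi> p X Y Z W" "\<Phi> p X Y Z 0 = 0"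
proof -
  have F: "F1 p (c *\<^sub>R X) Y = c * F1 p X Y" "F1 p X (c *\<^sub>R Y) = c * F1 p X Y"
    "F2 p (c *\<^sub>R X) Y = c * F2 p X Y" "F2 p X (c *\<^sub>R Y) = c * F2 p X Y"
    "F3 p (c *\<^sub>R X) Y = c * F3 p X Y" "F3 p X (c *\<^sub>R Y) = c * F3 p X Y" for c X Y
    by (simp_all add: F1_def F2_def F3_def \<sigma>1_def \<sigma>2_def \<sigma>3_def wedge11_def coframe_linear algebra_simps diff_divide_distrib)
  show S: "\<Phi> p (c *\<^sub>R X) Y Z W = c * \<Phi> p X Y Z W" "\<Phi> p X (c *\<^sub>R Y) Z W = c * \<Phi> p X Y Z W"
    "\<Phi> p X Y (c *\<^sub>R Z) W = c * \<Phi> p X Y Z W"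
    by (simp_all add: \<Phi>_def wedge22_self F algebra_simps)
  have "F1 p X 0 = 0" "F2 p X 0 = 0" "F3 p X 0 = 0" for X
    using F(2,4,6)[of X 0 0] by simp_all
  then show "\<Phi> p X Y Z 0 = 0"
    by (simp add: \<Phi>_def wedge22_self)
qed

lemma parallel_imp_reciprocal_sum:
  assumes p: "p \<in> M" "fst p = 0"
    and parallel: "parallel_form4_on M g (fundamental_form g Q)"
  shows "1 / w1 p + 1 / w2 p + 1 / w3 p = 3 / w1 p" "1 / w1 p + 1 / w2 p + 1 / w3 p = 3 / w2 p"
proof -
  note w = w_pos[OF p(1)] and rp = r_pos[OF p(1)] and r9 = r_pow9[OF p(1)]
  have cov: "dir_deriv (\<lambda>q. \<Phi> q X Y Z W) p V
     - \<Phi> p (levi_civita g p V X) Y Z W - \<Phi> p X (levi_civita g p V Y) Z W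
     - \<Phi> p X Y (levi_civita g p V Z) W - \<Phi> p X Y Z (levi_civita g p V W) = 0" for V X Y Z W
    using parallel[unfolded parallel_form4_on_def cov_deriv4_def, rule_format, OF p(1), of X Y Z W V]
    unfolding fundamental_form_Q[OF p(1)] dir_deriv_fundamental_form_Q[OF p(1)] .
  \<comment> \<open>After cancelling the common factor h, the relation r^9 = x y z gives 8 r'/r -
    2/x = 2/(3 x), so r'/r = 1/(3 x). By definition r'/r is also one ninth of the sum of
    reciprocals.\<close>
  have key: "1 / w1 p + 1 / w2 p + 1 / w3 p = 3 / x"
    if pos: "x > 0" "y > 0" "z > 0" and xyz: "r p ^ 9 = x * y * z"
      and eq: "- (6 / C * (r p ^ 8 / x ^ 2) / (C * r p) * (12 * z)) - 6 / C * (r p ^ 8 / x ^ 2) / (C * r p) * (12 * z)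
        - - (6 / C * (r p ^ 8 / x ^ 2) * (8 * r' p / r p - 2 / x)) / (2 * ((C / 6) ^ 3 / r p ^ 6)) * (C ^ 2 / 3 * (r p ^ 2 / y)) = 0"
    for x y z
  proof -
    have "- (h / (C * r p) * (12 * z)) - h / (C * r p) * (12 * z)
        - - (h * t) / (2 * ((C / 6) ^ 3 / r p ^ 6)) * (C ^ 2 / 3 * (r p ^ 2 / y))
        = h * (36 * r p ^ 8 / (C * y) * t - 24 * z / (C * r p))" for h t
      using pos rp C_pos by (simp add: field_simps eval_nat_numeral)
    from eq[unfolded this] have "36 * r p ^ 8 / (C * y) * (8 * r' p / r p - 2 / x) = 24 * z / (C * r p)"
      using pos rp C_pos unfolding mult_eq_0_iff by simp
    then have "3 * (r p ^ 8 * r p) * (8 * r' p / r p - 2 / x) = 2 * (y * z)"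
      using pos rp C_pos by (simp add: divide_simps)
    then have "3 * r p ^ 9 * (8 * r' p / r p - 2 / x) = 2 * (y * z)"
      by (simp add: power_Suc2[symmetric])
    moreover have "t = 2 / (3 * x)" if "3 * (x * y * z) * t = 2 * (y * z)" for t
      using that pos by (simp add: field_simps)
    ultimately have "8 * r' p / r p - 2 / x = 2 / (3 * x)"
      unfolding xyz by blast
    then have "r' p / r p = 1 / (3 * x)"
      using pos rp by (simp add: field_simps)
    moreover have "r' p / r p = (1 / w1 p + 1 / w2 p + 1 / w3 p) / 9"
      using rp by (simp add: r'_def)
    ultimately have "(1 / w1 p + 1 / w2 p + 1 / w3 p) / 9 = 1 / (3 * x)"
      by (rule trans[OF sym, rotated])
    moreover have "s = 3 / x" if "s / 9 = 1 / (3 * x)" for s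
      using that pos by (simp add: field_simps)
    ultimately show ?thesis by blast
  qed
  \<comment> \<open>Along \<open>dx 5\<close> the connection takes \<open>dx 1\<close> to
    \<open>dx 2\<close>, \<open>dx 3\<close> to \<open>dx 4\<close> and \<open>dx 5\<close> to
    \<open>du\<close>, up to factors, and kills \<open>dx 6\<close>; each of the first three hits a
    known component of \<Phi>.\<close>
  have eq1: "- (6 / C * (r p ^ 8 / w1 p ^ 2) / (C * r p) * (12 * w3 p)) - 6 / C * (r p ^ 8 / w1 p ^ 2) / (C * r p) * (12 * w3 p)
        - - (6 / C * (r p ^ 8 / w1 p ^ 2) * (8 * r' p / r p - 2 / w1 p)) / (2 * ((C / 6) ^ 3 / r p ^ 6)) * (C ^ 2 / 3 * (r p ^ 2 / w2 p)) = 0"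
    using cov[where V = "dx 5" and X = "dx 1" and Y = "dx 3" and Z = "dx 5" and W = "dx 6"]
    unfolding levi_civita_dx[OF p] \<Phi>_linear \<Phi>_dx[OF p]
    by (subst (asm) dir_deriv_\<Phi>_vertical[OF p(1)]) (simp_all add: coframe_dx[OF p(2)])
  \<comment> \<open>The cyclically shifted choice, with \<open>dx 6\<close> as direction.\<close>
  have eq2: "- (6 / C * (r p ^ 8 / w2 p ^ 2) / (C * r p) * (12 * w1 p)) - 6 / C * (r p ^ 8 / w2 p ^ 2) / (C * r p) * (12 * w1 p)
        - - (6 / C * (r p ^ 8 / w2 p ^ 2) * (8 * r' p / r p - 2 / w2 p)) / (2 * ((C / 6) ^ 3 / r p ^ 6)) * (C ^ 2 / 3 * (r p ^ 2 / w3 p)) = 0"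
    using cov[where V = "dx 6" and X = "dx 1" and Y = "dx 4" and Z = "dx 6" and W = "dx 7"]
    unfolding levi_civita_dx[OF p] \<Phi>_linear \<Phi>_dx[OF p]
    by (subst (asm) dir_deriv_\<Phi>_vertical[OF p(1)]) (simp_all add: coframe_dx[OF p(2)])
  show "1 / w1 p + 1 / w2 p + 1 / w3 p = 3 / w1 p"
    by (rule key[OF w(1,2,3) _ eq1]) (simp add: r9)
  show "1 / w1 p + 1 / w2 p + 1 / w3 p = 3 / w2 p"
    by (rule key[OF w(2,3,1) _ eq2]) (simp add: r9)
qed

lemma parallel_imp_equal:
  assumes "parallel_form4_on M g (fundamental_form g Q)"
  shows "a1 = a2 \<and> a2 = a3"
proof -
  \<comment> \<open>This value of u makes every u + a_s at least 1, so the domain has a point over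
    the origin.\<close>
  define p :: heis_space where "p = (0, \<bar>a1\<bar> + \<bar>a2\<bar> + \<bar>a3\<bar> + 1)"
  have p: "p \<in> M" "fst p = 0"
    by (auto simp: p_def mem_M w1_def w2_def w3_def)
  note w = w_pos[OF p(1)] and eq = parallel_imp_reciprocal_sum[OF p assms]
  have "3 / w1 p = 3 / w2 p"
    using eq by metis
  then have 12: "w1 p = w2 p"
    by simp
  then have "w3 p = w1 p"
    using eq(1) w by (simp add: field_simps)
  then show ?thesis
    using 12 by (simp add: w1_def w2_def w3_def)
qed

end

theorem theorem4p12:
  fixes C a1 a2 a3 :: real
  assumes "C > 0" and "\<not> (a1 = a2 \<and> a2 = a3)"
  shows "\<exists>Q. almost_quaternion_hermitian (heis_domain a1 a2 a3) (heis_metric C a1 a2 a3) Q \<and>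
             closed_form4_on (heis_domain a1 a2 a3) (fundamental_form (heis_metric C a1 a2 a3) Q) \<and>
             \<not> quaternionic_kaehler (heis_domain a1 a2 a3) (heis_metric C a1 a2 a3) Q"
proof -
  interpret heis C a1 a2 a3
    using assms(1) by unfold_locales
  show ?thesis
    using almost_quaternion_hermitian_Q closed_fundamental_form_Q parallel_imp_equal assms(2)
    unfolding quaternionic_kaehler_def by blast
qed

end
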